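(* For each hemiring $R$ let $\Sigma_R$ be a given class of left $R$-semimodules $M$ with $RM\neq 0$, and let $\Sigma$ be the union of all the classes $\Sigma_R$. Put $\ker(\Sigma_R):=\bigcap\{(0:M)_R \mid M\in\Sigma_R\}$. Assume that for every hemiring $R$ and every ideal $I$ of $R$: (SM1) if $M\in\Sigma_{R/I}$, then $M\in\Sigma_R$; (SM2) if $M\in\Sigma_R$ and $I\subseteq(0:M)_R$, then $M\in\Sigma_{R/I}$; and that for every hemiring $R$: (SM3) if $\ker(\Sigma_R)=0$, then $\Sigma_I\neq\emptyset$ for all nonzero ideals $I$ of $R$; (SM4) if $\Sigma_I\neq\emptyset$ for each nonzero ideal $I$ of $R$, then $\ker(\Sigma_R)=0$. Let $\Re(\Sigma):=\{R\in\mathbb{H}\mid \Sigma_R=\emptyset\}$, and let $\mathcal{F}(\Sigma)$ be the class of all hemirings $R$ for which $\Sigma_R$ contains a faithful semimodule. Then: (i) a hemiring $R$ is $\Re(\Sigma)$-semisimple (i.e. $\varrho_{\Re(\Sigma)}(R)=0$) if and only if $R$ is semiisomorphic to a subdirect product of hemirings in $\mathcal{F}(\Sigma)$; (ii) $\varrho_{\Re(\Sigma)}(R)=\ker(\Sigma_R)$ for every hemiring $R$.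
   Context: A hemiring $(R,+,\cdot,0)$ consists of a commutative monoid $(R,+,0)$ and a semigroup $(R,\cdot)$ such that multiplication distributes over addition on both sides and $0r=0=r0$ for all $r$. A semiring is a hemiring with a multiplicative identity $1$. $\mathbb{H}$ is the class of all hemirings. Ideals are two-sided and are regarded as hemirings. For an ideal $I$ of $R$, $R/I$ is the factor hemiring of $R$ by the Bourne congruence: $r\equiv_I r'$ iff $r+x=r'+x'$ for some $x,x'\in I$. A left $R$-semimodule is a commutative monoid $(M,+,0_M)$ with a scalar multiplication $R\times M\to M$ satisfying $(rr')m=r(r'm)$, $r(m+m')=rm+rm'$, $(r+r')m=rm+r'm$, $r0_M=0_M=0m$ (and unitary when $R$ is a semiring). The annihilator is $(0:M)_R=\{r\in R\mid rM=0\}$; $M$ is faithful if $(0:M)_R=0$. If $M$ is a left $R/I$-semimodule, it is a left $R$-semimodule via $rm=\overline{r}m$; if $M$ is a left $R$-semimodule and $I\subseteq(0:M)_R$, it is a left $R/I$-semimodule via $\overline{r}m=rm$. These identifications are used in (SM1) and (SM2). The intersection over an empty class is $R$. Under the stated conditions $\Re(\Sigma)$ is a radical class of hemirings, and $\varrho_{\Re(\Sigma)}(R)$ denotes the union of all ideals of $R$ that belong to $\Re(\Sigma)$ (it is the greatest such ideal of $R$). A semiisomorphism is a surjective hemiring homomorphism $f:R\to S$ with $\mathrm{Ker}(f):=\{a\mid f(a)=0\}=0$; $R$ is semiisomorphic to $S$ if there is a semiisomorphism $R\to S$. A subdirect product of hemirings $(R_i)_{i\in I}$ is a subhemiring $S$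 of the direct product $\prod_{i\in I}R_i$ such that every projection $\pi_i$ restricted to $S$ is surjective onto $R_i$.
   Formalization: The "if" half of (i) is proved assuming ℜ(Σ) is closed under homomorphic images, which (SM1)–(SM4) do not imply and without which it fails (ℕ → {0,1}, 1+1=1); ℜ(Σ) is assumed isomorphism-closed throughout. "Only if" and (ii) do not need the former. *)

theory Defs
  imports "HOL-Algebra.Module"
begin

section \<open>Hemirings, ideals and homomorphisms\<close>

text \<open>Hemirings live on the record \<open>'a ring\<close> of HOL-Algebra. A hemiring need not have a
  multiplicative identity, so nothing below constrains the field \<open>one\<close> of that record.\<close>

locale hemiring = abelian_monoid R for R :: "'a ring" (structure) +
  assumes m_closed: "\<lbrakk>x \<in> carrier R; y \<in> carrier R\<rbrakk> \<Longrightarrow> x \<otimes> y \<in> carrier R"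
    and m_assoc: "\<lbrakk>x \<in> carrier R; y \<in> carrier R; z \<in> carrier R\<rbrakk>
      \<Longrightarrow> (x \<otimes> y) \<otimes> z = x \<otimes> (y \<otimes> z)"
    and l_distr: "\<lbrakk>x \<in> carrier R; y \<in> carrier R; z \<in> carrier R\<rbrakk>
      \<Longrightarrow> (x \<oplus> y) \<otimes> z = x \<otimes> z \<oplus> y \<otimes> z"
    and r_distr: "\<lbrakk>x \<in> carrier R; y \<in> carrier R; z \<in> carrier R\<rbrakk>
      \<Longrightarrow> z \<otimes> (x \<oplus> y) = z \<otimes> x \<oplus> z \<otimes> y"
    and l_null: "x \<in> carrier R \<Longrightarrow> \<zero> \<otimes> x = \<zero>"
    and r_null: "x \<in> carrier R \<Longrightarrow> x \<otimes> \<zero> = \<zero>"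

definition subhemiring :: "'a set \<Rightarrow> 'a ring \<Rightarrow> bool" where
  "subhemiring S R \<longleftrightarrow> submonoid S (add_monoid R) \<and> (\<forall>x\<in>S. \<forall>y\<in>S. x \<otimes>\<^bsub>R\<^esub> y \<in> S)"

definition hideal :: "'a set \<Rightarrow> 'a ring \<Rightarrow> bool" where
  "hideal I R \<longleftrightarrow> submonoid I (add_monoid R) \<and>
     (\<forall>a\<in>I. \<forall>r\<in>carrier R. r \<otimes>\<^bsub>R\<^esub> a \<in> I \<and> a \<otimes>\<^bsub>R\<^esub> r \<in> I)"

text \<open>An ideal (or subhemiring) \<open>I\<close> of \<open>R\<close> regarded as a hemiring.\<close>

abbreviation restr :: "'a ring \<Rightarrow> 'a set \<Rightarrow> 'a ring" where
  "restr R I \<equiv> R\<lparr>carrier := I\<rparr>"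

definition hemiring_hom :: "'a ring \<Rightarrow> 'b ring \<Rightarrow> ('a \<Rightarrow> 'b) set" where
  "hemiring_hom R S = {f \<in> carrier R \<rightarrow> carrier S.
     f \<zero>\<^bsub>R\<^esub> = \<zero>\<^bsub>S\<^esub> \<and>
     (\<forall>x\<in>carrier R. \<forall>y\<in>carrier R.
        f (x \<oplus>\<^bsub>R\<^esub> y) = f x \<oplus>\<^bsub>S\<^esub> f y \<and> f (x \<otimes>\<^bsub>R\<^esub> y) = f x \<otimes>\<^bsub>S\<^esub> f y)}"

definition hemiring_iso :: "'a ring \<Rightarrow> 'b ring \<Rightarrow> ('a \<Rightarrow> 'b) set" where
  "hemiring_iso R S = {f \<in> hemiring_hom R S. bij_betw f (carrier R) (carrier S)}"

definition semiisomorphism :: "'a ring \<Rightarrow> 'b ring \<Rightarrow> ('a \<Rightarrow> 'b) \<Rightarrow> bool" where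
  "semiisomorphism R S f \<longleftrightarrow> f \<in> hemiring_hom R S \<and> f ` carrier R = carrier S \<and>
     {a \<in> carrier R. f a = \<zero>\<^bsub>S\<^esub>} = {\<zero>\<^bsub>R\<^esub>}"


section \<open>Factor hemirings by the Bourne congruence\<close>

definition bourne :: "'a ring \<Rightarrow> 'a set \<Rightarrow> ('a \<times> 'a) set" where
  "bourne R I = {(r, r'). r \<in> carrier R \<and> r' \<in> carrier R \<and>
     (\<exists>x\<in>I. \<exists>x'\<in>I. r \<oplus>\<^bsub>R\<^esub> x = r' \<oplus>\<^bsub>R\<^esub> x')}"

text \<open>The elements of \<open>R/I\<close> are represented by one chosen member of each congruence class rather
  than by the classes themselves. This keeps \<open>R/I\<close> in the type of \<open>R\<close>, so that a single function
  \<open>\<Sigma>\<close> on \<open>'a ring\<close> can be evaluated at \<open>R\<close>, at its ideals and at its factor hemirings.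
  \<open>bourne_rep R I\<close> plays the role of \<open>r \<mapsto> \<bar>r\<close>; see \<open>bourne_rep_eq_iff\<close> and \<open>factor_hemiring\<close>.\<close>

definition bourne_rep :: "'a ring \<Rightarrow> 'a set \<Rightarrow> 'a \<Rightarrow> 'a" where
  "bourne_rep R I r = (SOME s. s \<in> bourne R I `` {r})"

definition factor :: "'a ring \<Rightarrow> 'a set \<Rightarrow> 'a ring" where
  "factor R I = \<lparr>carrier = bourne_rep R I ` carrier R,
     mult = (\<lambda>x y. bourne_rep R I (x \<otimes>\<^bsub>R\<^esub> y)),
     one = bourne_rep R I \<one>\<^bsub>R\<^esub>,
     zero = bourne_rep R I \<zero>\<^bsub>R\<^esub>,
     add = (\<lambda>x y. bourne_rep R I (x \<oplus>\<^bsub>R\<^esub> y))\<rparr>"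

lemma hideal_props:
  assumes "hemiring R" "hideal I R"
  shows "I \<subseteq> carrier R" "\<zero>\<^bsub>R\<^esub> \<in> I" "\<And>x y. x \<in> I \<Longrightarrow> y \<in> I \<Longrightarrow> x \<oplus>\<^bsub>R\<^esub> y \<in> I"
    "\<And>x r. x \<in> I \<Longrightarrow> r \<in> carrier R \<Longrightarrow> r \<otimes>\<^bsub>R\<^esub> x \<in> I"
    "\<And>x r. x \<in> I \<Longrightarrow> r \<in> carrier R \<Longrightarrow> x \<otimes>\<^bsub>R\<^esub> r \<in> I"
  using assms(2) unfolding hideal_def submonoid_def by auto

lemma bourne_equiv:
  fixes R :: "'a ring" (structure)
  assumes R: "hemiring R" and I: "hideal I R"
  shows "equiv (carrier R) (bourne R I)"
proof (rule equivI)
  interpret hemiring R by fact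
  note Ip = hideal_props[OF R I]
  show "bourne R I \<subseteq> carrier R \<times> carrier R" by (auto simp: bourne_def)
  show "refl_on (carrier R) (bourne R I)"
    using Ip(2) by (auto simp: refl_on_def bourne_def)
  show "sym (bourne R I)" by (auto simp: sym_def bourne_def) metis
  show "trans (bourne R I)"
  proof (rule transI)
    fix r s t assume "(r, s) \<in> bourne R I" "(s, t) \<in> bourne R I"
    then obtain x x' y y' where *: "r \<in> carrier R" "s \<in> carrier R" "t \<in> carrier R"
        "x \<in> I" "x' \<in> I" "y \<in> I" "y' \<in> I"
        "r \<oplus> x = s \<oplus> x'" "s \<oplus> y = t \<oplus> y'"
      by (auto simp: bourne_def)
    have c: "x \<in> carrier R" "x' \<in> carrier R" "y \<in> carrier R" "y' \<in> carrier R"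
      using * Ip(1) by auto
    have "r \<oplus> (x \<oplus> y) = (r \<oplus> x) \<oplus> y" using *(1-7) c by (simp add: a_assoc)
    also have "\<dots> = (s \<oplus> x') \<oplus> y" using * by simp
    also have "\<dots> = (s \<oplus> y) \<oplus> x'" using *(1-7) c by (simp add: a_ac)
    also have "\<dots> = t \<oplus> (y' \<oplus> x')" using * c by (simp add: a_assoc)
    finally show "(r, t) \<in> bourne R I" using * Ip(3) by (auto simp: bourne_def)
  qed
qed

lemma bourne_rep_mem:
  assumes "hemiring R" "hideal I R" "r \<in> carrier R"
  shows "(r, bourne_rep R I r) \<in> bourne R I"
proof -
  have "\<exists>s. s \<in> bourne R I `` {r}"
    using equiv_class_self[OF bourne_equiv[OF assms(1,2)] assms(3)] by blast
  from someI_ex[OF this] show ?thesis by (simp add: bourne_rep_def)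
qed

lemma bourne_rep_eq_iff:
  assumes "hemiring R" "hideal I R" "r \<in> carrier R" "s \<in> carrier R"
  shows "bourne_rep R I r = bourne_rep R I s \<longleftrightarrow> (r, s) \<in> bourne R I"
proof
  note E = bourne_equiv[OF assms(1,2)]
  show "(r, s) \<in> bourne R I" if "bourne_rep R I r = bourne_rep R I s"
    using bourne_rep_mem[OF assms(1-3)] bourne_rep_mem[OF assms(1,2,4)] that E
    by (metis equivE symE transE)
  show "bourne_rep R I r = bourne_rep R I s" if "(r, s) \<in> bourne R I"
    using equiv_class_eq[OF E that] by (simp add: bourne_rep_def)
qed

lemma bourne_cong:
  fixes R :: "'a ring" (structure)
  assumes R: "hemiring R" and I: "hideal I R"
    and "(r, r') \<in> bourne R I" "(s, s') \<in> bourne R I"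
  shows "(r \<oplus>\<^bsub>R\<^esub> s, r' \<oplus>\<^bsub>R\<^esub> s') \<in> bourne R I" "(r \<otimes>\<^bsub>R\<^esub> s, r' \<otimes>\<^bsub>R\<^esub> s') \<in> bourne R I"
proof -
  interpret hemiring R by fact
  note Ip = hideal_props[OF R I]
  obtain x x' y y' where *: "r \<in> carrier R" "r' \<in> carrier R" "s \<in> carrier R" "s' \<in> carrier R"
      "x \<in> I" "x' \<in> I" "y \<in> I" "y' \<in> I"
      "r \<oplus> x = r' \<oplus> x'" "s \<oplus> y = s' \<oplus> y'"
    using assms(3,4) by (auto simp: bourne_def)
  have c: "x \<in> carrier R" "x' \<in> carrier R" "y \<in> carrier R" "y' \<in> carrier R"
    using * Ip(1) by auto
  have "(r \<oplus> s) \<oplus> (x \<oplus> y) = (r \<oplus> x) \<oplus> (s \<oplus> y)" using *(1-8) c by (simp add: a_ac)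
  also have "\<dots> = (r' \<oplus> x') \<oplus> (s' \<oplus> y')" using * by simp
  also have "\<dots> = (r' \<oplus> s') \<oplus> (x' \<oplus> y')" using *(1-8) c by (simp add: a_ac)
  finally show "(r \<oplus> s, r' \<oplus> s') \<in> bourne R I"
    unfolding bourne_def using * Ip(3) by blast
  have "r \<otimes> s \<oplus> x \<otimes> s = r' \<otimes> s \<oplus> x' \<otimes> s"
    using *(9) * c by (metis l_distr)
  then have 1: "(r \<otimes> s, r' \<otimes> s) \<in> bourne R I"
    unfolding bourne_def using * Ip(5) m_closed by blast
  have "r' \<otimes> s \<oplus> r' \<otimes> y = r' \<otimes> s' \<oplus> r' \<otimes> y'"
    using *(10) * c by (metis r_distr)
  then have "(r' \<otimes> s, r' \<otimes> s') \<in> bourne R I"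
    unfolding bourne_def using * Ip(4) m_closed by blast
  with 1 show "(r \<otimes> s, r' \<otimes> s') \<in> bourne R I"
    using bourne_equiv[OF R I] by (meson equivE transE)
qed

lemma factor_hemiring:
  fixes R :: "'a ring" (structure)
  assumes R: "hemiring R" and I: "hideal I R"
  shows "bourne_rep R I \<in> hemiring_hom R (factor R I)" "hemiring (factor R I)"
proof -
  interpret hemiring R by fact
  let ?\<rho> = "bourne_rep R I" and ?F = "factor R I"
  note mem = bourne_rep_mem[OF R I] and eq = bourne_rep_eq_iff[OF R I]
  have cl: "?\<rho> r \<in> carrier R" if "r \<in> carrier R" for r
    using mem[OF that] by (auto simp: bourne_def)
  have add: "?\<rho> x \<oplus>\<^bsub>?F\<^esub> ?\<rho> y = ?\<rho> (x \<oplus> y)" and mul: "?\<rho> x \<otimes>\<^bsub>?F\<^esub> ?\<rho> y = ?\<rho> (x \<otimes> y)"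
    if "x \<in> carrier R" "y \<in> carrier R" for x y
    using that bourne_cong[OF R I mem[OF that(1)] mem[OF that(2)]] cl m_closed eq
    by (simp_all add: factor_def) (metis a_closed)+
  have zero: "\<zero>\<^bsub>?F\<^esub> = ?\<rho> \<zero>" and car: "carrier ?F = ?\<rho> ` carrier R"
    by (simp_all add: factor_def)
  show "?\<rho> \<in> hemiring_hom R ?F"
    using add mul by (auto simp: hemiring_hom_def zero car)
  show "hemiring ?F"
  proof (unfold_locales, unfold car monoid.simps partial_object.simps zero)
  qed (auto simp: car zero add mul a_ac m_closed m_assoc l_distr r_distr l_null r_null)
qed


section \<open>Left semimodules\<close>

text \<open>On \<open>('a, 'm) module\<close> only the fields \<open>carrier\<close>, \<open>add\<close>, \<open>zero\<close> and \<open>smult\<close> are used, as in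
  HOL-Algebra. Unitarity is required whenever \<open>R\<close> has a multiplicative identity.\<close>

locale left_semimodule = hemiring R + M: abelian_monoid M
  for R :: "'a ring" (structure) and M :: "('a, 'm) module" (structure) +
  assumes smult_closed: "\<lbrakk>r \<in> carrier R; m \<in> carrier M\<rbrakk> \<Longrightarrow> r \<odot>\<^bsub>M\<^esub> m \<in> carrier M"
    and smult_assoc: "\<lbrakk>r \<in> carrier R; s \<in> carrier R; m \<in> carrier M\<rbrakk>
      \<Longrightarrow> (r \<otimes> s) \<odot>\<^bsub>M\<^esub> m = r \<odot>\<^bsub>M\<^esub> (s \<odot>\<^bsub>M\<^esub> m)"
    and smult_r_distr: "\<lbrakk>r \<in> carrier R; m \<in> carrier M; n \<in> carrier M\<rbrakk>
      \<Longrightarrow> r \<odot>\<^bsub>M\<^esub> (m \<oplus>\<^bsub>M\<^esub> n) = r \<odot>\<^bsub>M\<^esub> m \<oplus>\<^bsub>M\<^esub> r \<odot>\<^bsub>M\<^esub> n"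
    and smult_l_distr: "\<lbrakk>r \<in> carrier R; s \<in> carrier R; m \<in> carrier M\<rbrakk>
      \<Longrightarrow> (r \<oplus> s) \<odot>\<^bsub>M\<^esub> m = r \<odot>\<^bsub>M\<^esub> m \<oplus>\<^bsub>M\<^esub> s \<odot>\<^bsub>M\<^esub> m"
    and smult_r_null: "r \<in> carrier R \<Longrightarrow> r \<odot>\<^bsub>M\<^esub> \<zero>\<^bsub>M\<^esub> = \<zero>\<^bsub>M\<^esub>"
    and smult_l_null: "m \<in> carrier M \<Longrightarrow> \<zero> \<odot>\<^bsub>M\<^esub> m = \<zero>\<^bsub>M\<^esub>"
    and unitary: "\<lbrakk>e \<in> carrier R; \<forall>r\<in>carrier R. e \<otimes> r = r \<and> r \<otimes> e = r; m \<in> carrier M\<rbrakk>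
      \<Longrightarrow> e \<odot>\<^bsub>M\<^esub> m = m"

text \<open>The set \<open>RM\<close> of products; it is \<open>{0}\<close> iff the additive submonoid it generates is.\<close>

definition smult_image :: "'a ring \<Rightarrow> ('a, 'm) module \<Rightarrow> 'm set" where
  "smult_image R M = {r \<odot>\<^bsub>M\<^esub> m | r m. r \<in> carrier R \<and> m \<in> carrier M}"

definition annihilator :: "'a ring \<Rightarrow> ('a, 'm) module \<Rightarrow> 'a set" where
  "annihilator R M = {r \<in> carrier R. \<forall>m\<in>carrier M. r \<odot>\<^bsub>M\<^esub> m = \<zero>\<^bsub>M\<^esub>}"

text \<open>An \<open>R/I\<close>-semimodule viewed as an \<open>R\<close>-semimodule. The opposite identification, for
  \<open>I \<subseteq> (0:M)\<^sub>R\<close>, needs no operation: since the carrier of \<open>factor R I\<close> consists of elements of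
  \<open>R\<close>, the record \<open>M\<close> itself serves as the \<open>R/I\<close>-semimodule.\<close>

definition inflate :: "'a ring \<Rightarrow> 'a set \<Rightarrow> ('a, 'm) module \<Rightarrow> ('a, 'm) module" where
  "inflate R I M = M\<lparr>smult := (\<lambda>r m. bourne_rep R I r \<odot>\<^bsub>M\<^esub> m)\<rparr>"


section \<open>Classes of semimodules and classes of hemirings\<close>

text \<open>The types \<open>'u\<close> and \<open>'m\<close> are the universes in which the hemirings and the semimodules live;
  \<open>\<Sigma> R\<close> is the class \<open>\<Sigma>\<^sub>R\<close>.\<close>

type_synonym ('u, 'm) semimod_classes = "'u ring \<Rightarrow> ('u, 'm) module set"

definition ker_class :: "('u, 'm) semimod_classes \<Rightarrow> 'u ring \<Rightarrow> 'u set" where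
  "ker_class \<Sigma> R = carrier R \<inter> (\<Inter>M\<in>\<Sigma> R. annihilator R M)"

definition rad_class :: "('u, 'm) semimod_classes \<Rightarrow> 'u ring set" where
  "rad_class \<Sigma> = {R. hemiring R \<and> \<Sigma> R = {}}"

definition faithful_class :: "('u, 'm) semimod_classes \<Rightarrow> 'u ring set" where
  "faithful_class \<Sigma> = {R. hemiring R \<and> (\<exists>M\<in>\<Sigma> R. annihilator R M = {\<zero>\<^bsub>R\<^esub>})}"

definition radical :: "'u ring set \<Rightarrow> 'u ring \<Rightarrow> 'u set" where
  "radical \<C> R = \<Union>{I. hideal I R \<and> restr R I \<in> \<C>}"

definition semisimple :: "'u ring set \<Rightarrow> 'u ring \<Rightarrow> bool" where
  "semisimple \<C> R \<longleftrightarrow> radical \<C> R = {\<zero>\<^bsub>R\<^esub>}"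

definition iso_closed :: "'u ring set \<Rightarrow> bool" where
  "iso_closed \<C> \<longleftrightarrow>
     (\<forall>R\<in>\<C>. \<forall>S. hemiring S \<longrightarrow> hemiring_iso R S \<noteq> {} \<longrightarrow> S \<in> \<C>)"

text \<open>Closure under all surjective homomorphisms, as required of a radical class. For
  \<open>rad_class \<Sigma>\<close> it is not automatic: factoring by Bourne congruences does not reach
  semiisomorphic images such as \<open>\<nat> \<rightarrow> {0, 1}\<close> with \<open>1 + 1 = 1\<close>.\<close>

definition hom_closed :: "'u ring set \<Rightarrow> bool" where
  "hom_closed \<C> \<longleftrightarrow>
     (\<forall>R\<in>\<C>. \<forall>S. hemiring S \<longrightarrow> (\<exists>f\<in>hemiring_hom R S. f ` carrier R = carrier S) \<longrightarrow> S \<in> \<C>)"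


section \<open>Subdirect products\<close>

definition direct_product :: "'i set \<Rightarrow> ('i \<Rightarrow> 'a ring) \<Rightarrow> ('i \<Rightarrow> 'a) ring" where
  "direct_product A \<R> = \<lparr>carrier = (\<Pi>\<^sub>E i\<in>A. carrier (\<R> i)),
     mult = (\<lambda>x y. \<lambda>i\<in>A. x i \<otimes>\<^bsub>\<R> i\<^esub> y i),
     one = (\<lambda>i\<in>A. \<one>\<^bsub>\<R> i\<^esub>),
     zero = (\<lambda>i\<in>A. \<zero>\<^bsub>\<R> i\<^esub>),
     add = (\<lambda>x y. \<lambda>i\<in>A. x i \<oplus>\<^bsub>\<R> i\<^esub> y i)\<rparr>"

definition subdirect_product :: "'i set \<Rightarrow> ('i \<Rightarrow> 'a ring) \<Rightarrow> ('i \<Rightarrow> 'a) set \<Rightarrow> bool" where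
  "subdirect_product A \<R> S \<longleftrightarrow> subhemiring S (direct_product A \<R>) \<and>
     (\<forall>i\<in>A. (\<lambda>x. x i) ` S = carrier (\<R> i))"

text \<open>\<open>R\<close> is semiisomorphic to a subdirect product of a family of members of \<open>\<C>\<close> indexed by some
  subset of the type \<open>'i\<close>.\<close>

definition semiiso_subdirect :: "'i itself \<Rightarrow> 'u ring set \<Rightarrow> 'u ring \<Rightarrow> bool" where
  "semiiso_subdirect _ \<C> R \<longleftrightarrow> (\<exists>(A :: 'i set) \<R> S f. (\<forall>i\<in>A. \<R> i \<in> \<C>) \<and>
     subdirect_product A \<R> S \<and> semiisomorphism R (restr (direct_product A \<R>) S) f)"

end

theory Submission
  imports Defs
begin

text \<open>Write \<open>\<C>\<close> for \<open>\<Re>(\<Sigma>)\<close>. Taken together, (SM3) and (SM4) say that \<open>ker(\<Sigma>\<^sub>R) = 0\<close> iff \<open>R\<close> has no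
  nonzero ideal in \<open>\<C>\<close>, i.e. iff \<open>R\<close> is semisimple (\<open>semisimple_iff_ker\<close>). This condition on \<open>R\<close> depends
  only on \<open>\<C>\<close> and is therefore invariant under isomorphism, although the individual classes
  \<open>\<Sigma>\<^sub>R\<close> need not be. By (SM2), \<open>R/ker(\<Sigma>\<^sub>R)\<close> is always semisimple; by (SM1), if \<open>R/Q\<close> is
  semisimple then \<open>ker(\<Sigma>\<^sub>R)\<close> becomes zero in \<open>R/Q\<close>. Moreover \<open>R\<close> lies in \<open>\<C>\<close> iff
  \<open>ker(\<Sigma>\<^sub>R) = R\<close>, because \<open>RM \<noteq> 0\<close> for \<open>M \<in> \<Sigma>\<^sub>R\<close>.

  The delicate half of (ii) is that an ideal \<open>I\<close> of \<open>R\<close> in \<open>\<C>\<close> lies in \<open>K = ker(\<Sigma>\<^sub>R)\<close>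
  (\<open>rad_ideal_subset_ker\<close>). Let \<open>J\<close> be the image of \<open>I\<close> in the semisimple hemiring \<open>R/K\<close>. For
  rings \<open>J\<close> is \<open>I/(I \<inter> K)\<close> and inherits membership in \<open>\<C>\<close>. For hemirings \<open>J\<close> is only a
  semiisomorphic image of that factor hemiring, and \<open>\<C>\<close> need not be closed under such images.
  What remains true is that elements of \<open>I\<close> with the same image act alike: from
  \<open>i + k = i' + k'\<close> with \<open>k, k' \<in> K\<close> it follows that \<open>ji + jk = ji' + jk'\<close>, where \<open>jk, jk'\<close> lie in
  \<open>I \<inter> K\<close>. This is enough (\<open>semisimple_image_trivial\<close>): suppose that a semisimple \<open>D \<noteq> 0\<close> is an image
  of \<open>I\<close> of this kind. If \<open>D\<close> is a ring, it is a factor hemiring of \<open>I\<close> and so in \<open>\<C>\<close>. Otherwise \<open>I\<close>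
  and \<open>D\<close> can be glued to a semisimple hemiring having a nonzero factor hemiring of \<open>I\<close> as an ideal.
  Both are absurd, since semisimple hemirings have no nonzero ideals in \<open>\<C>\<close>.

  Consequently the ideals of \<open>R\<close> in \<open>\<C>\<close> are closed under sums, and their union \<open>W\<close> is one of them:
  each of them lies in \<open>ker(\<Sigma>\<^sub>W)\<close>, so that this ideal is all of \<open>W\<close>. By (SM2) the preimage in \<open>R\<close> of
  an ideal of \<open>R/W\<close> in \<open>\<C>\<close> is again in \<open>\<C>\<close>, hence contained in \<open>W\<close>. So \<open>R/W\<close> is semisimple, which
  gives \<open>ker(\<Sigma>\<^sub>R) \<subseteq> W\<close>.

  For (i), a semisimple \<open>R\<close> is semiisomorphic to a subdirect product of the hemirings
  \<open>R/(0:M)\<close>, over each of which \<open>M\<close> is faithful. Conversely, the projections of an ideal in \<open>\<C>\<close> to the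
  subdirect factors are ideals in \<open>\<C>\<close> by closure under homomorphic images, and these are zero because hemirings with
  a faithful semimodule in \<open>\<Sigma>\<close> are semisimple.\<close>

section \<open>Homomorphisms, ideals and factor hemirings\<close>

lemma hideal_iff:
  "hideal I R \<longleftrightarrow> I \<subseteq> carrier R \<and> \<zero>\<^bsub>R\<^esub> \<in> I \<and> (\<forall>x\<in>I. \<forall>y\<in>I. x \<oplus>\<^bsub>R\<^esub> y \<in> I) \<and>
     (\<forall>x\<in>I. \<forall>r\<in>carrier R. r \<otimes>\<^bsub>R\<^esub> x \<in> I \<and> x \<otimes>\<^bsub>R\<^esub> r \<in> I)"
  unfolding hideal_def submonoid_def by auto

lemma hemiring_homD:
  assumes "f \<in> hemiring_hom R S"
  shows "\<And>x. x \<in> carrier R \<Longrightarrow> f x \<in> carrier S" "f \<zero>\<^bsub>R\<^esub> = \<zero>\<^bsub>S\<^esub>"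
    "\<And>x y. x \<in> carrier R \<Longrightarrow> y \<in> carrier R \<Longrightarrow> f (x \<oplus>\<^bsub>R\<^esub> y) = f x \<oplus>\<^bsub>S\<^esub> f y"
    "\<And>x y. x \<in> carrier R \<Longrightarrow> y \<in> carrier R \<Longrightarrow> f (x \<otimes>\<^bsub>R\<^esub> y) = f x \<otimes>\<^bsub>S\<^esub> f y"
  using assms by (auto simp: hemiring_hom_def)

lemma hemiring_restr:
  assumes "hemiring R" "hideal I R" shows "hemiring (restr R I)"
proof -
  interpret hemiring R by fact
  note p = hideal_props[OF assms]
  have c: "x \<in> carrier R" if "x \<in> I" for x using p(1) that by blast
  show ?thesis
    by unfold_locales
      (auto simp: p c a_ac m_assoc l_distr r_distr l_null r_null)
qed

lemma hemiring_image:
  assumes "hemiring R" and f: "f \<in> hemiring_hom R S" "f ` carrier R = carrier S"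
  shows "hemiring S"
proof -
  interpret hemiring R by fact
  note h = hemiring_homD(2-4)[OF f(1), symmetric]
  interpret S: abelian_monoid S
  proof (rule abelian_monoidI)
    show "x \<oplus>\<^bsub>S\<^esub> y = y \<oplus>\<^bsub>S\<^esub> x" if "x \<in> carrier S" "y \<in> carrier S" for x y
      using that a_comm by (auto simp: f(2)[symmetric] h)
  qed (auto simp: f(2)[symmetric] h a_assoc)
  show ?thesis
    by unfold_locales
      (auto simp: f(2)[symmetric] h m_closed m_assoc l_distr r_distr l_null r_null)
qed

lemma hideal_restr:
  assumes "hideal J R" "J \<subseteq> I" "I \<subseteq> carrier R" shows "hideal J (restr R I)"
  using assms unfolding hideal_iff by auto

lemma hideal_image:
  assumes f: "f \<in> hemiring_hom R S" "f ` carrier R = carrier S" and I: "hideal I R"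
  shows "hideal (f ` I) S"
  unfolding hideal_iff
proof (intro conjI ballI)
  note h = hemiring_homD[OF f(1)]
  have I': "I \<subseteq> carrier R" "\<zero>\<^bsub>R\<^esub> \<in> I" using I by (auto simp: hideal_iff)
  show "f ` I \<subseteq> carrier S" using I' f(2) by auto
  show "\<zero>\<^bsub>S\<^esub> \<in> f ` I" using I' h(2) by force
  show "x \<oplus>\<^bsub>S\<^esub> y \<in> f ` I" if "x \<in> f ` I" "y \<in> f ` I" for x y
    using that I I' h(3)[symmetric] by (auto simp: hideal_iff subset_iff)
  show "r \<otimes>\<^bsub>S\<^esub> x \<in> f ` I" "x \<otimes>\<^bsub>S\<^esub> r \<in> f ` I" if "x \<in> f ` I" "r \<in> carrier S" for x r
    using that I I' h(4)[symmetric] by (auto simp: hideal_iff subset_iff f(2)[symmetric])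
qed

lemma hideal_vimage:
  assumes "hemiring R" and f: "f \<in> hemiring_hom R S" and J: "hideal J S"
  shows "hideal {r \<in> carrier R. f r \<in> J} R"
proof -
  interpret hemiring R by fact
  show ?thesis
    using J hemiring_homD[OF f] by (auto simp: hideal_iff m_closed)
qed

lemma hideal_zero:
  assumes "hemiring R" shows "hideal {\<zero>\<^bsub>R\<^esub>} R"
proof -
  interpret hemiring R by fact
  show ?thesis by (auto simp: hideal_iff l_null r_null)
qed

lemma hemiring_hom_restr:
  assumes f: "f \<in> hemiring_hom R S" and I: "I \<subseteq> carrier R"
  shows "f \<in> hemiring_hom (restr R I) (restr S (f ` I))"
  using hemiring_homD[OF f] I by (auto simp: hemiring_hom_def subset_iff)

lemma hemiring_iso_restr:
  assumes f: "f \<in> hemiring_iso R S" and I: "I \<subseteq> carrier R"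
  shows "f \<in> hemiring_iso (restr R I) (restr S (f ` I))"
  using f hemiring_hom_restr[OF _ I] I
  by (auto simp: hemiring_iso_def bij_betw_def intro: inj_on_subset)

lemma hemiring_iso_inv:
  assumes "hemiring R" and f: "f \<in> hemiring_iso R S"
  shows "inv_into (carrier R) f \<in> hemiring_iso S R"
proof -
  interpret hemiring R by fact
  have b: "bij_betw f (carrier R) (carrier S)" and h: "f \<in> hemiring_hom R S"
    using f by (auto simp: hemiring_iso_def)
  note H = hemiring_homD[OF h]
  let ?g = "inv_into (carrier R) f"
  have gf: "?g (f x) = x" if "x \<in> carrier R" for x
    using b that by (auto simp: bij_betw_def)
  have S: "carrier S = f ` carrier R" using b by (auto simp: bij_betw_def)
  have "?g \<in> hemiring_hom S R"
    using gf[of "\<zero>\<^bsub>R\<^esub>"] by (auto simp: hemiring_hom_def S gf m_closed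
        H(3,4)[symmetric] H(2))
  then show ?thesis using bij_betw_inv_into[OF b] by (simp add: hemiring_iso_def)
qed

lemma bourne_hom_eq:
  assumes R: "hemiring R" and D: "hemiring D" and q: "q \<in> hemiring_hom R D"
    and Q: "\<And>x. x \<in> Q \<Longrightarrow> x \<in> carrier R \<and> q x = \<zero>\<^bsub>D\<^esub>" and xy: "(x, y) \<in> bourne R Q"
  shows "q x = q y"
proof -
  interpret D: hemiring D by fact
  note H = hemiring_homD[OF q]
  from xy obtain a b where *: "x \<in> carrier R" "y \<in> carrier R" "a \<in> Q" "b \<in> Q"
      "x \<oplus>\<^bsub>R\<^esub> a = y \<oplus>\<^bsub>R\<^esub> b" by (auto simp: bourne_def)
  then have "q x \<oplus>\<^bsub>D\<^esub> q a = q y \<oplus>\<^bsub>D\<^esub> q b" using Q H(3) by metis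
  then show ?thesis using * Q H(1) by simp
qed

text \<open>Elements of a factor hemiring are themselves representatives, so a homomorphism on \<open>R\<close>
  that induces an isomorphism on \<open>R/Q\<close> is itself that isomorphism.\<close>

lemma factor_iso:
  assumes R: "hemiring R" and D: "hemiring D" and Q: "hideal Q R"
    and q: "q \<in> hemiring_hom R D" "q ` carrier R = carrier D"
    and kills: "\<And>x. x \<in> Q \<Longrightarrow> q x = \<zero>\<^bsub>D\<^esub>"
    and cong: "\<And>x y. x \<in> carrier R \<Longrightarrow> y \<in> carrier R \<Longrightarrow> q x = q y \<Longrightarrow> (x, y) \<in> bourne R Q"
  shows "q \<in> hemiring_iso (factor R Q) D"
proof -
  interpret hemiring R by fact
  let ?\<rho> = "bourne_rep R Q"
  note H = hemiring_homD[OF q(1)]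
  note Qp = hideal_props[OF R Q]
  have mem: "?\<rho> x \<in> carrier R" "q (?\<rho> x) = q x" if "x \<in> carrier R" for x
    using bourne_rep_mem[OF R Q that] bourne_hom_eq[OF R D q(1)] kills Qp(1)
    by (auto simp: bourne_def subset_iff) metis
  have hom: "q \<in> hemiring_hom (factor R Q) D"
    using H mem by (auto simp: hemiring_hom_def factor_def m_closed)
  have "inj_on q (carrier (factor R Q))"
    using mem cong bourne_rep_eq_iff[OF R Q] by (auto simp: inj_on_def factor_def)
  moreover have "q ` carrier (factor R Q) = carrier D"
    using mem(2) q(2) by (simp add: factor_def image_image)
  ultimately show ?thesis using hom by (simp add: hemiring_iso_def bij_betw_def)
qed

lemma factor_carrier:
  assumes R: "hemiring R" and I: "hideal I R"
  shows "carrier (factor R I) = bourne_rep R I ` carrier R" "carrier (factor R I) \<subseteq> carrier R"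
    "\<zero>\<^bsub>factor R I\<^esub> = bourne_rep R I \<zero>\<^bsub>R\<^esub>"
    "\<And>s. s \<in> carrier (factor R I) \<Longrightarrow> bourne_rep R I s = s"
proof -
  show c: "carrier (factor R I) = bourne_rep R I ` carrier R"
    "\<zero>\<^bsub>factor R I\<^esub> = bourne_rep R I \<zero>\<^bsub>R\<^esub>" by (auto simp: factor_def)
  have m: "bourne_rep R I x \<in> carrier R" if "x \<in> carrier R" for x
    using bourne_rep_mem[OF R I that] by (auto simp: bourne_def)
  then show "carrier (factor R I) \<subseteq> carrier R" using c by auto
  show "bourne_rep R I s = s" if "s \<in> carrier (factor R I)" for s
    using that c m bourne_rep_mem[OF R I] bourne_rep_eq_iff[OF R I] by (auto; metis)
qed

text \<open>The class of zero is not \<open>I\<close> but its subtractive closure.\<close>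

lemma bourne_zero_iff:
  assumes R: "hemiring R" and I: "hideal I R" and r: "r \<in> carrier R"
  shows "bourne_rep R I r = \<zero>\<^bsub>factor R I\<^esub> \<longleftrightarrow> (\<exists>x\<in>I. r \<oplus>\<^bsub>R\<^esub> x \<in> I)"
proof -
  interpret hemiring R by fact
  note p = hideal_props[OF R I]
  have "bourne_rep R I r = \<zero>\<^bsub>factor R I\<^esub> \<longleftrightarrow> (r, \<zero>\<^bsub>R\<^esub>) \<in> bourne R I"
    using bourne_rep_eq_iff[OF R I r] by (simp add: factor_carrier(3)[OF R I])
  also have "\<dots> \<longleftrightarrow> (\<exists>x\<in>I. r \<oplus>\<^bsub>R\<^esub> x \<in> I)"
    using p(1) r by (auto simp: bourne_def subset_iff; metis l_zero)
  finally show ?thesis .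
qed

section \<open>Products and homomorphic images\<close>

definition prod_hemiring :: "'a ring \<Rightarrow> 'b ring \<Rightarrow> ('a \<times> 'b) ring" where
  "prod_hemiring R S = \<lparr>carrier = carrier R \<times> carrier S,
     mult = (\<lambda>x y. (fst x \<otimes>\<^bsub>R\<^esub> fst y, snd x \<otimes>\<^bsub>S\<^esub> snd y)),
     one = (\<one>\<^bsub>R\<^esub>, \<one>\<^bsub>S\<^esub>), zero = (\<zero>\<^bsub>R\<^esub>, \<zero>\<^bsub>S\<^esub>),
     add = (\<lambda>x y. (fst x \<oplus>\<^bsub>R\<^esub> fst y, snd x \<oplus>\<^bsub>S\<^esub> snd y))\<rparr>"

lemma hemiring_prod:
  assumes "hemiring R" "hemiring S" shows "hemiring (prod_hemiring R S)"
proof -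
  interpret R: hemiring R by fact
  interpret S: hemiring S by fact
  show ?thesis
    by unfold_locales (auto simp: prod_hemiring_def R.a_ac S.a_ac R.m_closed S.m_closed
      R.m_assoc S.m_assoc R.l_distr S.l_distr R.r_distr S.r_distr R.l_null S.l_null R.r_null S.r_null)
qed

text \<open>The quotient of \<open>S\<close> by the kernel relation of \<open>\<rho>\<close>, carried by the range of \<open>\<rho>\<close>. Unlike
  \<open>factor\<close> it allows arbitrary congruences and moves the quotient to another type.\<close>

definition image_hemiring :: "('b \<Rightarrow> 'a) \<Rightarrow> 'b ring \<Rightarrow> 'a ring" where
  "image_hemiring \<rho> S = (let \<sigma> = inv_into (carrier S) \<rho> in
     \<lparr>carrier = \<rho> ` carrier S, mult = (\<lambda>x y. \<rho> (\<sigma> x \<otimes>\<^bsub>S\<^esub> \<sigma> y)), one = \<rho> \<one>\<^bsub>S\<^esub>, zero = \<rho> \<zero>\<^bsub>S\<^esub>,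
      add = (\<lambda>x y. \<rho> (\<sigma> x \<oplus>\<^bsub>S\<^esub> \<sigma> y))\<rparr>)"

lemma image_hemiring_hom:
  assumes S: "hemiring S"
    and cong: "\<And>x x' y y'. \<lbrakk>x \<in> carrier S; x' \<in> carrier S; y \<in> carrier S; y' \<in> carrier S;
      \<rho> x = \<rho> x'; \<rho> y = \<rho> y'\<rbrakk> \<Longrightarrow> \<rho> (x \<oplus>\<^bsub>S\<^esub> y) = \<rho> (x' \<oplus>\<^bsub>S\<^esub> y') \<and> \<rho> (x \<otimes>\<^bsub>S\<^esub> y) = \<rho> (x' \<otimes>\<^bsub>S\<^esub> y')"
  shows "\<rho> \<in> hemiring_hom S (image_hemiring \<rho> S)"
    "\<rho> ` carrier S = carrier (image_hemiring \<rho> S)" "hemiring (image_hemiring \<rho> S)"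
proof -
  let ?\<sigma> = "inv_into (carrier S) \<rho>"
  have \<sigma>: "?\<sigma> (\<rho> x) \<in> carrier S" "\<rho> (?\<sigma> (\<rho> x)) = \<rho> x" if "x \<in> carrier S" for x
    using that by (auto intro: inv_into_into f_inv_into_f)
  show hom: "\<rho> \<in> hemiring_hom S (image_hemiring \<rho> S)"
    unfolding hemiring_hom_def
  proof (intro CollectI conjI ballI Pi_I)
    fix x y assume xy: "x \<in> carrier S" "y \<in> carrier S"
    show "\<rho> (x \<oplus>\<^bsub>S\<^esub> y) = \<rho> x \<oplus>\<^bsub>image_hemiring \<rho> S\<^esub> \<rho> y"
      "\<rho> (x \<otimes>\<^bsub>S\<^esub> y) = \<rho> x \<otimes>\<^bsub>image_hemiring \<rho> S\<^esub> \<rho> y"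
      using cong[OF \<sigma>(1)[OF xy(1)] xy(1) \<sigma>(1)[OF xy(2)] xy(2) \<sigma>(2)[OF xy(1)] \<sigma>(2)[OF xy(2)]]
      by (simp_all add: image_hemiring_def Let_def)
  qed (simp_all add: image_hemiring_def Let_def)
  show im: "\<rho> ` carrier S = carrier (image_hemiring \<rho> S)"
    by (simp add: image_hemiring_def Let_def)
  show "hemiring (image_hemiring \<rho> S)" by (rule hemiring_image[OF S hom im])
qed

text \<open>The universal property of \<open>T\<close> as a quotient of \<open>S\<close>, used to read off maps from image hemirings.\<close>

lemma hom_lift:
  assumes S: "hemiring S" and \<rho>: "\<rho> \<in> hemiring_hom S T" "\<rho> ` carrier S = carrier T"
    and h: "h \<in> hemiring_hom S D" "h ` carrier S = carrier D"
    and cong: "\<And>x y. x \<in> carrier S \<Longrightarrow> y \<in> carrier S \<Longrightarrow> \<rho> x = \<rho> y \<Longrightarrow> h x = h y"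
  obtains q where "q \<in> hemiring_hom T D" "q ` carrier T = carrier D"
    "\<And>x. x \<in> carrier S \<Longrightarrow> q (\<rho> x) = h x"
proof
  interpret S: hemiring S by fact
  let ?q = "\<lambda>t. h (inv_into (carrier S) \<rho> t)"
  show q: "?q (\<rho> x) = h x" if "x \<in> carrier S" for x
    using that by (intro cong) (auto intro: inv_into_into f_inv_into_f)
  show "?q ` carrier T = carrier D"
    using q by (force simp: \<rho>(2)[symmetric] h(2)[symmetric])
  note R = hemiring_homD[OF \<rho>(1)] and H = hemiring_homD[OF h(1)]
  show "?q \<in> hemiring_hom T D"
    using q[of "\<zero>\<^bsub>S\<^esub>"]
    by (auto simp: hemiring_hom_def \<rho>(2)[symmetric] q R(2) R(3,4)[symmetric] S.m_closed H)
qed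

lemma infinite_pairing:
  assumes "infinite (UNIV :: 'u set)"
  obtains e :: "'u \<times> 'u \<Rightarrow> 'u" where "inj e"
proof -
  have "(card_of (UNIV \<times> UNIV :: ('u \<times> 'u) set), card_of (UNIV :: 'u set)) \<in> ordIso"
    using card_of_Times_same_infinite[OF assms] by simp
  then obtain e :: "'u \<times> 'u \<Rightarrow> 'u" where "bij_betw e (UNIV \<times> UNIV) UNIV"
    using card_of_ordIso by blast
  then show ?thesis using that by (auto simp: bij_betw_def)
qed

section \<open>Annihilators\<close>

lemma (in left_semimodule) hideal_annihilator: "hideal (annihilator R M) R"
  by (auto simp: hideal_iff annihilator_def m_closed smult_assoc smult_l_distr smult_r_null
      smult_l_null smult_closed)

text \<open>Since annihilators are subtractive, the class of zero in \<open>R/(0:M)\<close> is exactly \<open>(0:M)\<close>. The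
  same passes to their intersection \<open>ker(\<Sigma>\<^sub>R)\<close>.\<close>

lemma (in left_semimodule) annihilator_subtractive:
  assumes "r \<in> carrier R" "x \<in> annihilator R M" "r \<oplus> x \<in> annihilator R M"
  shows "r \<in> annihilator R M"
  using assms smult_l_distr smult_closed by (force simp: annihilator_def)

section \<open>The radical of a family of semimodules\<close>

locale radical_semimodules =
  fixes \<Sigma> :: "('u, 'm) semimod_classes"
  assumes universe: "infinite (UNIV :: 'u set)"
    and semimodules: "\<And>R M. hemiring R \<Longrightarrow> M \<in> \<Sigma> R \<Longrightarrow>
      left_semimodule R M \<and> smult_image R M \<noteq> {\<zero>\<^bsub>M\<^esub>}"
    and abstract: "iso_closed (rad_class \<Sigma>)"
    and SM1: "\<And>R I M. hemiring R \<Longrightarrow> hideal I R \<Longrightarrow> M \<in> \<Sigma> (factor R I) \<Longrightarrow>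
      inflate R I M \<in> \<Sigma> R"
    and SM2: "\<And>R I M. hemiring R \<Longrightarrow> hideal I R \<Longrightarrow> M \<in> \<Sigma> R \<Longrightarrow> I \<subseteq> annihilator R M \<Longrightarrow>
      M \<in> \<Sigma> (factor R I)"
    and SM3: "\<And>R I. hemiring R \<Longrightarrow> ker_class \<Sigma> R = {\<zero>\<^bsub>R\<^esub>} \<Longrightarrow>
      hideal I R \<Longrightarrow> I \<noteq> {\<zero>\<^bsub>R\<^esub>} \<Longrightarrow> \<Sigma> (restr R I) \<noteq> {}"
    and SM4: "\<And>R. hemiring R \<Longrightarrow>
      (\<And>I. hideal I R \<Longrightarrow> I \<noteq> {\<zero>\<^bsub>R\<^esub>} \<Longrightarrow> \<Sigma> (restr R I) \<noteq> {}) \<Longrightarrow> ker_class \<Sigma> R = {\<zero>\<^bsub>R\<^esub>}"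
begin

abbreviation "\<C> \<equiv> rad_class \<Sigma>"

lemma hideal_ker:
  assumes R: "hemiring R" shows "hideal (ker_class \<Sigma> R) R"
proof -
  interpret hemiring R by fact
  have "hideal (annihilator R M) R" if "M \<in> \<Sigma> R" for M
    using semimodules[OF R that] left_semimodule.hideal_annihilator by blast
  then show ?thesis
    unfolding ker_class_def by (auto simp: hideal_iff m_closed)
qed

lemma ker_subtractive:
  assumes R: "hemiring R" and r: "r \<in> carrier R"
    and x: "x \<in> ker_class \<Sigma> R" "r \<oplus>\<^bsub>R\<^esub> x \<in> ker_class \<Sigma> R"
  shows "r \<in> ker_class \<Sigma> R"
proof -
  have "r \<in> annihilator R M" if M: "M \<in> \<Sigma> R" for M
  proof -
    have *: "left_semimodule R M" "x \<in> annihilator R M" "r \<oplus>\<^bsub>R\<^esub> x \<in> annihilator R M"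
      using x M semimodules[OF R M] by (auto simp: ker_class_def)
    show ?thesis by (rule left_semimodule.annihilator_subtractive[OF *(1) r *(2,3)])
  qed
  then show ?thesis using r by (auto simp: ker_class_def)
qed

text \<open>No \<open>M \<in> \<Sigma>\<^sub>R\<close> is annihilated by all of \<open>R\<close>, as \<open>RM \<noteq> 0\<close>; so membership in \<open>\<C>\<close> can be tested on the
  ideal \<open>ker(\<Sigma>\<^sub>R)\<close>.\<close>

lemma rad_class_eq_ker:
  assumes R: "hemiring R" shows "R \<in> \<C> \<longleftrightarrow> ker_class \<Sigma> R = carrier R"
proof
  show "ker_class \<Sigma> R = carrier R" if "R \<in> \<C>"
    using that by (auto simp: rad_class_def ker_class_def)
  assume k: "ker_class \<Sigma> R = carrier R"
  have False if M: "M \<in> \<Sigma> R" for M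
  proof -
    interpret left_semimodule R M using semimodules[OF R M] by blast
    have "carrier R \<subseteq> annihilator R M" using k M by (auto simp: ker_class_def)
    then have "r \<odot>\<^bsub>M\<^esub> m = \<zero>\<^bsub>M\<^esub>" if "r \<in> carrier R" "m \<in> carrier M" for r m
      using that by (auto simp: annihilator_def)
    then have "smult_image R M \<subseteq> {\<zero>\<^bsub>M\<^esub>}" by (auto simp: smult_image_def)
    moreover have "\<zero>\<^bsub>R\<^esub> \<odot>\<^bsub>M\<^esub> \<zero>\<^bsub>M\<^esub> \<in> smult_image R M"
      unfolding smult_image_def using zero_closed M.zero_closed by blast
    ultimately have "smult_image R M = {\<zero>\<^bsub>M\<^esub>}" by auto
    then show False using semimodules[OF R M] by blast
  qed
  then show "R \<in> \<C>" using R by (auto simp: rad_class_def)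
qed

lemma restr_zero_rad:
  assumes R: "hemiring R" shows "restr R {\<zero>\<^bsub>R\<^esub>} \<in> \<C>"
proof -
  have h: "hemiring (restr R {\<zero>\<^bsub>R\<^esub>})" by (rule hemiring_restr[OF R hideal_zero[OF R]])
  have "ker_class \<Sigma> (restr R {\<zero>\<^bsub>R\<^esub>}) = carrier (restr R {\<zero>\<^bsub>R\<^esub>})"
    using hideal_ker[OF h] by (auto simp: hideal_iff)
  then show ?thesis using rad_class_eq_ker[OF h] by blast
qed

lemma semisimple_iff:
  assumes R: "hemiring R"
  shows "semisimple \<C> R \<longleftrightarrow> (\<forall>I. hideal I R \<longrightarrow> restr R I \<in> \<C> \<longrightarrow> I = {\<zero>\<^bsub>R\<^esub>})"
proof -
  have "\<zero>\<^bsub>R\<^esub> \<in> I" if "hideal I R" for I using that by (simp add: hideal_iff)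
  then show ?thesis
    using hideal_zero[OF R] restr_zero_rad[OF R] unfolding semisimple_def radical_def by blast
qed

text \<open>This trades the classes \<open>\<Sigma>\<^sub>R\<close>, which may change under isomorphisms of \<open>R\<close>, for
  the isomorphism-closed class \<open>\<C>\<close>.\<close>

lemma semisimple_iff_ker:
  assumes R: "hemiring R" shows "semisimple \<C> R \<longleftrightarrow> ker_class \<Sigma> R = {\<zero>\<^bsub>R\<^esub>}"
proof -
  have "restr R I \<in> \<C> \<longleftrightarrow> \<Sigma> (restr R I) = {}" if "hideal I R" for I
    using hemiring_restr[OF R that] by (simp add: rad_class_def)
  then show ?thesis
    unfolding semisimple_iff[OF R] using SM3[OF R] SM4[OF R] by metis
qed

lemma rad_iso:
  assumes "R \<in> \<C>" "hemiring S" "f \<in> hemiring_iso R S" shows "S \<in> \<C>"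
  using assms abstract by (auto simp: iso_closed_def)

lemma rad_factor:
  assumes R: "R \<in> \<C>" and I: "hideal I R" shows "factor R I \<in> \<C>"
proof -
  have h: "hemiring R" and e: "\<Sigma> R = {}" using R by (auto simp: rad_class_def)
  have "\<Sigma> (factor R I) = {}" using SM1[OF h I] e by blast
  then show ?thesis using factor_hemiring(2)[OF h I] by (simp add: rad_class_def)
qed

lemma semisimple_iso:
  assumes R: "hemiring R" and D: "hemiring D" and f: "f \<in> hemiring_iso R D"
    and ss: "semisimple \<C> D"
  shows "semisimple \<C> R"
  unfolding semisimple_iff[OF R]
proof (intro allI impI)
  fix I assume I: "hideal I R" and C: "restr R I \<in> \<C>"
  have h: "f \<in> hemiring_hom R D" and inj: "inj_on f (carrier R)" and im: "f ` carrier R = carrier D"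
    using f by (auto simp: hemiring_iso_def bij_betw_def)
  have c: "I \<subseteq> carrier R" "\<zero>\<^bsub>R\<^esub> \<in> I" using I by (auto simp: hideal_iff)
  have "hideal (f ` I) D" by (rule hideal_image[OF h im I])
  moreover from this have "restr D (f ` I) \<in> \<C>"
    by (intro rad_iso[OF C hemiring_restr hemiring_iso_restr[OF f c(1)]] D)
  ultimately have "f ` I = {\<zero>\<^bsub>D\<^esub>}" using ss semisimple_iff[OF D] by blast
  then have "f x = f \<zero>\<^bsub>R\<^esub>" if "x \<in> I" for x using that hemiring_homD(2)[OF h] by auto
  then have "x = \<zero>\<^bsub>R\<^esub>" if "x \<in> I" for x using that inj c by (meson inj_onD subsetD)
  then show "I = {\<zero>\<^bsub>R\<^esub>}" using c by blast
qed

lemma ker_rep: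
  assumes R: "hemiring R" and I: "hideal I R" and x: "x \<in> ker_class \<Sigma> R"
  shows "bourne_rep R I x \<in> ker_class \<Sigma> (factor R I)"
  using x SM1[OF R I] factor_carrier(1)[OF R I]
  by (fastforce simp: ker_class_def annihilator_def inflate_def)

text \<open>Here \<open>D\<close> is any isomorphic copy of \<open>R/Q\<close>: the hypotheses on \<open>q\<close> say that its kernel congruence
  is the Bourne congruence of \<open>Q\<close>.\<close>

lemma ker_subset_kernel:
  assumes R: "hemiring R" and D: "hemiring D" and Q: "hideal Q R"
    and q: "q \<in> hemiring_hom R D" "q ` carrier R = carrier D"
    and kills: "\<And>x. x \<in> Q \<Longrightarrow> q x = \<zero>\<^bsub>D\<^esub>"
    and cong: "\<And>x y. x \<in> carrier R \<Longrightarrow> y \<in> carrier R \<Longrightarrow> q x = q y \<Longrightarrow> (x, y) \<in> bourne R Q"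
    and ss: "semisimple \<C> D" and x: "x \<in> ker_class \<Sigma> R"
  shows "q x = \<zero>\<^bsub>D\<^esub>"
proof -
  interpret hemiring R by fact
  note F = factor_hemiring(2)[OF R Q]
  have "semisimple \<C> (factor R Q)"
    by (rule semisimple_iso[OF F D factor_iso[OF R D Q q kills cong] ss])
  then have "bourne_rep R Q x = \<zero>\<^bsub>factor R Q\<^esub>"
    using ker_rep[OF R Q x] semisimple_iff_ker[OF F] by auto
  moreover have xc: "x \<in> carrier R" using x by (auto simp: ker_class_def)
  ultimately have "(x, \<zero>\<^bsub>R\<^esub>) \<in> bourne R Q"
    using bourne_rep_eq_iff[OF R Q xc] by (simp add: factor_carrier(3)[OF R Q])
  then show ?thesis
    using bourne_hom_eq[OF R D q(1)] kills hideal_props(1)[OF R Q] hemiring_homD(2)[OF q(1)]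
    by (metis subsetD)
qed

text \<open>Every \<open>M \<in> \<Sigma>\<^sub>R\<close> is also in \<open>\<Sigma>\<close> over \<open>R/ker(\<Sigma>\<^sub>R)\<close> by (SM2), and together these \<open>M\<close> annihilate
  nothing but zero there.\<close>

lemma semisimple_factor_ker:
  assumes R: "hemiring R" shows "semisimple \<C> (factor R (ker_class \<Sigma> R))"
proof -
  let ?K = "ker_class \<Sigma> R"
  interpret hemiring R by fact
  note K = hideal_ker[OF R]
  note F = factor_hemiring(2)[OF R K]
  have "s = \<zero>\<^bsub>factor R ?K\<^esub>" if s: "s \<in> ker_class \<Sigma> (factor R ?K)" for s
  proof -
    have sF: "s \<in> carrier (factor R ?K)" using s by (auto simp: ker_class_def)
    have sR: "s \<in> carrier R" using sF factor_carrier(2)[OF R K] by blast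
    have "s \<in> annihilator R M" if M: "M \<in> \<Sigma> R" for M
    proof -
      have "M \<in> \<Sigma> (factor R ?K)" using M by (intro SM2[OF R K]) (auto simp: ker_class_def)
      then show ?thesis using s sR by (auto simp: ker_class_def annihilator_def)
    qed
    then have "s \<in> ?K" using sR by (auto simp: ker_class_def)
    then have "bourne_rep R ?K s = \<zero>\<^bsub>factor R ?K\<^esub>"
      using bourne_zero_iff[OF R K sR] hideal_props[OF R K] by blast
    then show ?thesis using factor_carrier(4)[OF R K sF] by simp
  qed
  moreover have "\<zero>\<^bsub>factor R ?K\<^esub> \<in> ker_class \<Sigma> (factor R ?K)"
    using hideal_ker[OF F] by (simp add: hideal_iff)
  ultimately show ?thesis using semisimple_iff_ker[OF F] by blast
qed

section \<open>Gluing a radical hemiring to a semisimple image\<close>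

text \<open>Let \<open>V\<close> be the ideal of additively invertible elements of \<open>D\<close>. If \<open>V = D\<close>, then \<open>D\<close> is a ring,
  \<open>g\<close> induces an isomorphism \<open>I/P \<rightarrow> D\<close>, and \<open>D\<close> is both semisimple and in \<open>\<C>\<close>. Otherwise let \<open>T\<close> be the
  quotient of \<open>I \<times> D\<close> in which \<open>(i, d)\<close> and \<open>(i', d)\<close> are identified if \<open>i \<equiv>\<^sub>P i'\<close> in case
  \<open>d \<in> V\<close>, and if \<open>g i = g i'\<close> in case \<open>d \<notin> V\<close>. Sums respect this because \<open>d + d' \<in> V\<close> forces
  \<open>d, d' \<in> V\<close>; products respect it by \<open>lift\<close>. The ideals \<open>A\<close> and \<open>B\<close> coming from \<open>0 \<times> D\<close> and
  \<open>I \<times> 0\<close> satisfy \<open>T/A \<cong> D \<cong> T/B\<close>: modulo \<open>A\<close> one may add an element outside \<open>V\<close> to the second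
  coordinate, after which only \<open>g i\<close> counts. Hence \<open>ker(\<Sigma>\<^sub>T)\<close> vanishes under both projections to
  \<open>D\<close>, so it is zero and \<open>T\<close> is semisimple. But \<open>B \<cong> I/P\<close> lies in \<open>\<C>\<close>, so \<open>B = 0\<close> and thus \<open>D = 0\<close>.\<close>

lemma semisimple_image_trivial:
  fixes I D :: "'u ring"
  assumes I: "I \<in> \<C>" and D: "hemiring D" and ss: "semisimple \<C> D"
    and g: "g \<in> hemiring_hom I D" "g ` carrier I = carrier D"
    and P: "P = {i \<in> carrier I. g i = \<zero>\<^bsub>D\<^esub>}"
    and lift: "\<And>i i' j. \<lbrakk>i \<in> carrier I; i' \<in> carrier I; j \<in> carrier I; g i = g i'\<rbrakk> \<Longrightarrow>
      (i \<otimes>\<^bsub>I\<^esub> j, i' \<otimes>\<^bsub>I\<^esub> j) \<in> bourne I P \<and> (j \<otimes>\<^bsub>I\<^esub> i, j \<otimes>\<^bsub>I\<^esub> i') \<in> bourne I P"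
  shows "carrier D = {\<zero>\<^bsub>D\<^esub>}"
proof -
  have hI: "hemiring I" using I by (auto simp: rad_class_def)
  interpret I: hemiring I by fact
  interpret D: hemiring D by fact
  note G = hemiring_homD[OF g(1)]
  have Pi: "hideal P I" using hideal_vimage[OF hI g(1) hideal_zero[OF D]] by (simp add: P)
  note Pp = hideal_props[OF hI Pi]
  have Pg: "x \<in> carrier I \<and> g x = \<zero>\<^bsub>D\<^esub>" if "x \<in> P" for x using that by (simp add: P)
  note bg = bourne_hom_eq[OF hI D g(1) Pg]
  note FP = rad_factor[OF I Pi]
  define V where "V = {d \<in> carrier D. \<exists>d'\<in>carrier D. d \<oplus>\<^bsub>D\<^esub> d' = \<zero>\<^bsub>D\<^esub>}"
  show ?thesis
  proof (cases "carrier D \<subseteq> V")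
    case True
    have "(i, i') \<in> bourne I P" if i: "i \<in> carrier I" "i' \<in> carrier I" and e: "g i = g i'" for i i'
    proof -
      have "g i \<in> V" using True G(1) i by blast
      then obtain d where "d \<in> carrier D" "g i \<oplus>\<^bsub>D\<^esub> d = \<zero>\<^bsub>D\<^esub>" by (auto simp: V_def)
      then obtain y where y: "y \<in> carrier I" "g i \<oplus>\<^bsub>D\<^esub> g y = \<zero>\<^bsub>D\<^esub>" using g(2) by (metis imageE)
      have "i' \<oplus>\<^bsub>I\<^esub> y \<in> P" "i \<oplus>\<^bsub>I\<^esub> y \<in> P" using i y e G(3) by (auto simp: P)
      moreover have "i \<oplus>\<^bsub>I\<^esub> (i' \<oplus>\<^bsub>I\<^esub> y) = i' \<oplus>\<^bsub>I\<^esub> (i \<oplus>\<^bsub>I\<^esub> y)" using i y by (simp add: I.a_ac)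
      ultimately show ?thesis unfolding bourne_def using i by blast
    qed
    then have "g \<in> hemiring_iso (factor I P) D"
      by (intro factor_iso[OF hI D Pi g]) (auto simp: P)
    then have "restr D (carrier D) \<in> \<C>" using rad_iso[OF FP D] by simp
    moreover have "hideal (carrier D) D" by (simp add: hideal_iff D.m_closed)
    ultimately show ?thesis using ss semisimple_iff[OF D] by blast
  next
    case False
    then obtain u where u: "u \<in> carrier D" "u \<notin> V" by blast
    have V0: "\<zero>\<^bsub>D\<^esub> \<in> V" by (auto simp: V_def)
    have Vl: "d \<in> V" if "d \<in> carrier D" "d' \<in> carrier D" "d \<oplus>\<^bsub>D\<^esub> d' \<in> V" for d d'
    proof -
      obtain w where w: "w \<in> carrier D" "(d \<oplus>\<^bsub>D\<^esub> d') \<oplus>\<^bsub>D\<^esub> w = \<zero>\<^bsub>D\<^esub>"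
        using \<open>d \<oplus>\<^bsub>D\<^esub> d' \<in> V\<close> by (auto simp: V_def)
      then have "d \<oplus>\<^bsub>D\<^esub> (d' \<oplus>\<^bsub>D\<^esub> w) = \<zero>\<^bsub>D\<^esub>" using that(1,2) by (simp add: D.a_assoc)
      then show ?thesis unfolding V_def using that(1,2) w(1) by blast
    qed
    have Vr: "d' \<in> V" if "d \<in> carrier D" "d' \<in> carrier D" "d \<oplus>\<^bsub>D\<^esub> d' \<in> V" for d d'
      using Vl[OF that(2,1)] that D.a_comm[OF that(1,2)] by simp
    \<comment> \<open>\<open>\<Sigma>\<close> applies to \<open>T\<close> only if \<open>T\<close> lives in the type \<open>'u\<close>, so pairs are coded by single elements.\<close>
    obtain e :: "'u \<times> 'u \<Rightarrow> 'u" where e: "inj e" using infinite_pairing[OF universe] by blast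
    define S where "S = prod_hemiring I D"
    have hS: "hemiring S" unfolding S_def by (rule hemiring_prod[OF hI D])
    have Ssimps: "carrier S = carrier I \<times> carrier D" "\<zero>\<^bsub>S\<^esub> = (\<zero>\<^bsub>I\<^esub>, \<zero>\<^bsub>D\<^esub>)"
      "\<And>x y. x \<oplus>\<^bsub>S\<^esub> y = (fst x \<oplus>\<^bsub>I\<^esub> fst y, snd x \<oplus>\<^bsub>D\<^esub> snd y)"
      "\<And>x y. x \<otimes>\<^bsub>S\<^esub> y = (fst x \<otimes>\<^bsub>I\<^esub> fst y, snd x \<otimes>\<^bsub>D\<^esub> snd y)"
      by (simp_all add: S_def prod_hemiring_def)
    define \<rho> where "\<rho> x = e (if snd x \<in> V then bourne_rep I P (fst x) else g (fst x), snd x)" for x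
    have \<rho>_eq: "\<rho> x = \<rho> y \<longleftrightarrow> snd x = snd y \<and>
        (if snd x \<in> V then (fst x, fst y) \<in> bourne I P else g (fst x) = g (fst y))"
      if "x \<in> carrier S" "y \<in> carrier S" for x y
    proof -
      have "fst x \<in> carrier I" "fst y \<in> carrier I" using that by (auto simp: Ssimps)
      then show ?thesis
        using bourne_rep_eq_iff[OF hI Pi, of "fst x" "fst y"] by (auto simp: \<rho>_def inj_eq[OF e])
    qed
    have \<rho>_g: "g (fst x) = g (fst y)" and \<rho>_snd: "snd x = snd y"
      if "x \<in> carrier S" "y \<in> carrier S" "\<rho> x = \<rho> y" for x y
      using that \<rho>_eq[OF that(1,2)] bg by (auto split: if_splits)
    have \<rho>_bourne: "\<rho> x = \<rho> y"
      if "x \<in> carrier S" "y \<in> carrier S" "snd x = snd y" "(fst x, fst y) \<in> bourne I P" for x y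
      using that \<rho>_eq[OF that(1,2)] bg[OF _ that(4)] by auto
    define T where "T = image_hemiring \<rho> S"
    have cong: "\<rho> (x \<oplus>\<^bsub>S\<^esub> y) = \<rho> (x' \<oplus>\<^bsub>S\<^esub> y') \<and> \<rho> (x \<otimes>\<^bsub>S\<^esub> y) = \<rho> (x' \<otimes>\<^bsub>S\<^esub> y')"
      if c: "x \<in> carrier S" "x' \<in> carrier S" "y \<in> carrier S" "y' \<in> carrier S"
        and r: "\<rho> x = \<rho> x'" "\<rho> y = \<rho> y'" for x x' y y'
    proof
      interpret S: hemiring S by fact
      have s: "snd x = snd x'" "snd y = snd y'" "g (fst x) = g (fst x')" "g (fst y) = g (fst y')"
        using \<rho>_g \<rho>_snd c r by blast+
      have f: "fst x \<in> carrier I" "fst x' \<in> carrier I" "fst y \<in> carrier I" "fst y' \<in> carrier I"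
        "snd x \<in> carrier D" "snd y \<in> carrier D"
        using c by (auto simp: Ssimps)
      have "(fst x \<oplus>\<^bsub>I\<^esub> fst y, fst x' \<oplus>\<^bsub>I\<^esub> fst y') \<in> bourne I P" if v: "snd x \<oplus>\<^bsub>D\<^esub> snd y \<in> V"
      proof -
        have "snd x \<in> V" "snd y \<in> V" using Vl Vr f v by blast+
        then have "(fst x, fst x') \<in> bourne I P" "(fst y, fst y') \<in> bourne I P"
          using \<rho>_eq[OF c(1,2)] \<rho>_eq[OF c(3,4)] r by auto
        then show ?thesis using bourne_cong(1)[OF hI Pi] by blast
      qed
      moreover have "g (fst x \<oplus>\<^bsub>I\<^esub> fst y) = g (fst x' \<oplus>\<^bsub>I\<^esub> fst y')" using s f G(3) by simp
      ultimately show "\<rho> (x \<oplus>\<^bsub>S\<^esub> y) = \<rho> (x' \<oplus>\<^bsub>S\<^esub> y')"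
        using \<rho>_eq[OF S.a_closed[OF c(1,3)] S.a_closed[OF c(2,4)]] s by (simp add: Ssimps)
      have "(fst x \<otimes>\<^bsub>I\<^esub> fst y, fst x' \<otimes>\<^bsub>I\<^esub> fst y) \<in> bourne I P"
        "(fst x' \<otimes>\<^bsub>I\<^esub> fst y, fst x' \<otimes>\<^bsub>I\<^esub> fst y') \<in> bourne I P"
        using lift f s by blast+
      then have "(fst x \<otimes>\<^bsub>I\<^esub> fst y, fst x' \<otimes>\<^bsub>I\<^esub> fst y') \<in> bourne I P"
        using bourne_equiv[OF hI Pi] by (meson equivE transE)
      then show "\<rho> (x \<otimes>\<^bsub>S\<^esub> y) = \<rho> (x' \<otimes>\<^bsub>S\<^esub> y')"
        by (intro \<rho>_bourne S.m_closed c) (simp_all add: Ssimps s)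
    qed
    note im = image_hemiring_hom[OF hS cong, folded T_def]
    have \<rho>h: "\<rho> \<in> hemiring_hom S T" and \<rho>i: "\<rho> ` carrier S = carrier T" and hT: "hemiring T"
      using im by blast+
    note RH = hemiring_homD[OF \<rho>h]
    have T0: "\<zero>\<^bsub>T\<^esub> = \<rho> (\<zero>\<^bsub>I\<^esub>, \<zero>\<^bsub>D\<^esub>)" using RH(2) by (simp add: Ssimps)
    have addT: "\<rho> (i, d) \<oplus>\<^bsub>T\<^esub> \<rho> (i', d') = \<rho> (i \<oplus>\<^bsub>I\<^esub> i', d \<oplus>\<^bsub>D\<^esub> d')"
      if "i \<in> carrier I" "i' \<in> carrier I" "d \<in> carrier D" "d' \<in> carrier D" for i i' d d'
      using RH(3)[of "(i, d)" "(i', d')"] that by (simp add: Ssimps)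
    have T_cases: "\<exists>i\<in>carrier I. \<exists>d\<in>carrier D. t = \<rho> (i, d)" if "t \<in> carrier T" for t
      using that unfolding \<rho>i[symmetric] Ssimps by blast
    have \<rho>T: "\<rho> (i, d) \<in> carrier T" if "i \<in> carrier I" "d \<in> carrier D" for i d
      using that RH(1)[of "(i, d)"] by (simp add: Ssimps)
    have "(\<lambda>x. g (fst x)) ` carrier S = g ` carrier I"
      using D.zero_closed by (auto simp: Ssimps intro!: image_eqI)
    then have "(\<lambda>x. g (fst x)) \<in> hemiring_hom S D" "(\<lambda>x. g (fst x)) ` carrier S = carrier D"
      using G g(2) by (auto simp: hemiring_hom_def Ssimps)
    from hom_lift[OF hS \<rho>h \<rho>i this \<rho>_g] obtain q1 where
      q1: "q1 \<in> hemiring_hom T D" "q1 ` carrier T = carrier D"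
        "\<And>x. x \<in> carrier S \<Longrightarrow> q1 (\<rho> x) = g (fst x)" by blast
    have "snd \<in> hemiring_hom S D" "snd ` carrier S = carrier D"
      using I.zero_closed by (auto simp: hemiring_hom_def Ssimps)
    from hom_lift[OF hS \<rho>h \<rho>i this \<rho>_snd] obtain q2 where
      q2: "q2 \<in> hemiring_hom T D" "q2 ` carrier T = carrier D"
        "\<And>x. x \<in> carrier S \<Longrightarrow> q2 (\<rho> x) = snd x" by blast
    have q1': "q1 (\<rho> (i, d)) = g i" and q2': "q2 (\<rho> (i, d)) = d"
      if "i \<in> carrier I" "d \<in> carrier D" for i d
      using q1(3)[of "(i, d)"] q2(3)[of "(i, d)"] that by (simp_all add: Ssimps)
    define A where "A = \<rho> ` ({\<zero>\<^bsub>I\<^esub>} \<times> carrier D)"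
    define B where "B = \<rho> ` (carrier I \<times> {\<zero>\<^bsub>D\<^esub>})"
    have A: "hideal A T" unfolding A_def
      by (rule hideal_image[OF \<rho>h \<rho>i])
        (auto simp: hideal_iff Ssimps I.l_null I.r_null D.m_closed)
    have B: "hideal B T" unfolding B_def
      by (rule hideal_image[OF \<rho>h \<rho>i])
        (auto simp: hideal_iff Ssimps D.l_null D.r_null I.m_closed)
    have k1: "q1 t = \<zero>\<^bsub>D\<^esub>" if t: "t \<in> ker_class \<Sigma> T" for t
    proof (rule ker_subset_kernel[OF hT D A q1(1,2) _ _ ss t])
      show "q1 x = \<zero>\<^bsub>D\<^esub>" if "x \<in> A" for x using that q1' G(2) by (auto simp: A_def)
      fix x y assume xy: "x \<in> carrier T" "y \<in> carrier T" "q1 x = q1 y"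
      obtain i d i' d' where x: "x = \<rho> (i, d)" "y = \<rho> (i', d')"
        and c: "i \<in> carrier I" "i' \<in> carrier I" "d \<in> carrier D" "d' \<in> carrier D"
        using T_cases[OF xy(1)] T_cases[OF xy(2)] by blast
      have gi: "g i = g i'" using xy(3) x c q1' by simp
      \<comment> \<open>Equalise the second coordinates by adding \<open>d' + u\<close> and \<open>d + u\<close>; the summand \<open>u\<close> keeps the
        common value outside \<open>V\<close>.\<close>
      let ?s = "d \<oplus>\<^bsub>D\<^esub> (d' \<oplus>\<^bsub>D\<^esub> u)"
      have s: "d' \<oplus>\<^bsub>D\<^esub> (d \<oplus>\<^bsub>D\<^esub> u) = ?s" using c u by (simp add: D.a_ac)
      have "?s \<notin> V" using Vr u c by (meson D.a_closed)
      then have "\<rho> (i, ?s) = \<rho> (i', ?s)"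
        using gi c u \<rho>_eq[of "(i, ?s)" "(i', ?s)"] by (simp add: Ssimps)
      then have "x \<oplus>\<^bsub>T\<^esub> \<rho> (\<zero>\<^bsub>I\<^esub>, d' \<oplus>\<^bsub>D\<^esub> u) = y \<oplus>\<^bsub>T\<^esub> \<rho> (\<zero>\<^bsub>I\<^esub>, d \<oplus>\<^bsub>D\<^esub> u)"
        using c u s by (simp add: x addT)
      moreover have "\<rho> (\<zero>\<^bsub>I\<^esub>, d' \<oplus>\<^bsub>D\<^esub> u) \<in> A" "\<rho> (\<zero>\<^bsub>I\<^esub>, d \<oplus>\<^bsub>D\<^esub> u) \<in> A"
        using c u by (auto simp: A_def)
      ultimately show "(x, y) \<in> bourne T A" unfolding bourne_def using xy by blast
    qed
    have k2: "q2 t = \<zero>\<^bsub>D\<^esub>" if t: "t \<in> ker_class \<Sigma> T" for t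
    proof (rule ker_subset_kernel[OF hT D B q2(1,2) _ _ ss t])
      show "q2 x = \<zero>\<^bsub>D\<^esub>" if "x \<in> B" for x using that q2' by (auto simp: B_def)
      fix x y assume xy: "x \<in> carrier T" "y \<in> carrier T" "q2 x = q2 y"
      obtain i d i' d' where x: "x = \<rho> (i, d)" "y = \<rho> (i', d')"
        and c: "i \<in> carrier I" "i' \<in> carrier I" "d \<in> carrier D" "d' \<in> carrier D"
        using T_cases[OF xy(1)] T_cases[OF xy(2)] by blast
      have "d = d'" using xy(3) x c q2' by simp
      then have "x \<oplus>\<^bsub>T\<^esub> \<rho> (i', \<zero>\<^bsub>D\<^esub>) = y \<oplus>\<^bsub>T\<^esub> \<rho> (i, \<zero>\<^bsub>D\<^esub>)"
        using c by (simp add: x addT I.a_comm)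
      moreover have "\<rho> (i', \<zero>\<^bsub>D\<^esub>) \<in> B" "\<rho> (i, \<zero>\<^bsub>D\<^esub>) \<in> B" using c by (auto simp: B_def)
      ultimately show "(x, y) \<in> bourne T B" unfolding bourne_def using xy by blast
    qed
    have zero_rel: "(i, \<zero>\<^bsub>I\<^esub>) \<in> bourne I P" if "i \<in> P" for i
    proof -
      have "i \<oplus>\<^bsub>I\<^esub> \<zero>\<^bsub>I\<^esub> = \<zero>\<^bsub>I\<^esub> \<oplus>\<^bsub>I\<^esub> i" using that Pp(1) by (simp add: subset_iff)
      then show ?thesis unfolding bourne_def using that Pp(1,2) by blast
    qed
    have rho0: "\<rho> (i, \<zero>\<^bsub>D\<^esub>) = \<zero>\<^bsub>T\<^esub>" if "i \<in> P" for i
      unfolding T0 using that Pp(1) zero_rel[OF that] by (intro \<rho>_bourne) (auto simp: Ssimps)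
    have "t = \<zero>\<^bsub>T\<^esub>" if t: "t \<in> ker_class \<Sigma> T" for t
    proof -
      have "t \<in> carrier T" using t by (simp add: ker_class_def)
      then obtain i d where x: "t = \<rho> (i, d)" and c: "i \<in> carrier I" "d \<in> carrier D"
        using T_cases by blast
      have "d = \<zero>\<^bsub>D\<^esub>" "g i = \<zero>\<^bsub>D\<^esub>" using k1[OF t] k2[OF t] q1' q2' x c by auto
      then show ?thesis using c x rho0 by (simp add: P)
    qed
    moreover have "\<zero>\<^bsub>T\<^esub> \<in> ker_class \<Sigma> T" using hideal_ker[OF hT] by (simp add: hideal_iff)
    ultimately have "ker_class \<Sigma> T = {\<zero>\<^bsub>T\<^esub>}" by blast
    then have ssT: "semisimple \<C> T" using semisimple_iff_ker[OF hT] by simp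
    let ?h = "\<lambda>i. \<rho> (i, \<zero>\<^bsub>D\<^esub>)"
    have hB: "hemiring (restr T B)" by (rule hemiring_restr[OF hT B])
    have hom: "?h \<in> hemiring_hom I (restr T B)"
      using RH(4)[of "(_, \<zero>\<^bsub>D\<^esub>)" "(_, \<zero>\<^bsub>D\<^esub>)"]
      by (auto simp: hemiring_hom_def T0 addT B_def Ssimps D.l_null)
    have "?h \<in> hemiring_iso (factor I P) (restr T B)"
    proof (rule factor_iso[OF hI hB Pi hom])
      show "?h ` carrier I = carrier (restr T B)" by (auto simp: B_def)
      show "?h x = \<zero>\<^bsub>restr T B\<^esub>" if "x \<in> P" for x using rho0[OF that] by simp
      show "(x, y) \<in> bourne I P" if "x \<in> carrier I" "y \<in> carrier I" "?h x = ?h y" for x y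
        using \<rho>_eq[of "(x, \<zero>\<^bsub>D\<^esub>)" "(y, \<zero>\<^bsub>D\<^esub>)"] that V0 by (simp add: Ssimps)
    qed
    then have "restr T B \<in> \<C>" by (rule rad_iso[OF FP hB])
    then have B0: "B = {\<zero>\<^bsub>T\<^esub>}" using ssT semisimple_iff[OF hT] B by blast
    have "g i = \<zero>\<^bsub>D\<^esub>" if i: "i \<in> carrier I" for i
    proof -
      have "?h i = \<zero>\<^bsub>T\<^esub>" using B0 i by (auto simp: B_def)
      then show ?thesis using q1'[OF i D.zero_closed] hemiring_homD(2)[OF q1(1)] by simp
    qed
    then have "carrier D \<subseteq> {\<zero>\<^bsub>D\<^esub>}" unfolding g(2)[symmetric] by blast
    then show ?thesis using D.zero_closed by blast
  qed
qed

section \<open>The radical equals the kernel\<close>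

text \<open>The image \<open>J\<close> of \<open>I\<close> in \<open>F = R/ker(\<Sigma>\<^sub>R)\<close> need not be semisimple itself, but
  \<open>D = J/ker(\<Sigma>\<^sub>J)\<close> is. The composite \<open>I \<rightarrow> J \<rightarrow> D\<close> identifies \<open>i\<close> and \<open>i'\<close> only if
  \<open>i + x + k = i' + x' + k'\<close> with \<open>x, x'\<close> in its kernel \<open>P\<close> and \<open>k, k' \<in> K\<close>. Multiplication by
  \<open>j \<in> I\<close> moves \<open>k\<close> and \<open>k'\<close> into \<open>I \<inter> K \<subseteq> P\<close>, so \<open>semisimple_image_trivial\<close> applies and
  \<open>D = 0\<close>. Then \<open>J\<close> is in \<open>\<C>\<close>, hence zero, as \<open>F\<close> is semisimple.\<close>

lemma rad_ideal_subset_ker: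
  fixes R :: "'u ring" (structure)
  assumes R: "hemiring R" and I: "hideal I R" and C: "restr R I \<in> \<C>"
  shows "I \<subseteq> ker_class \<Sigma> R"
proof -
  interpret hemiring R by fact
  define K where "K = ker_class \<Sigma> R"
  define F where "F = factor R K"
  define \<rho> where "\<rho> = bourne_rep R K"
  have K: "hideal K R" unfolding K_def by (rule hideal_ker[OF R])
  note Kp = hideal_props[OF R K] and Ip = hideal_props[OF R I]
  have F: "hemiring F" and \<rho>: "\<rho> \<in> hemiring_hom R F" "\<rho> ` carrier R = carrier F"
    using factor_hemiring[OF R K] factor_carrier(1)[OF R K] by (auto simp: F_def \<rho>_def)
  have \<rho>K: "\<rho> k = \<zero>\<^bsub>F\<^esub>" if "k \<in> K" for k
    using that Kp bourne_zero_iff[OF R K, of k] unfolding \<rho>_def F_def by blast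
  define J where "J = \<rho> ` I"
  have J: "hideal J F" unfolding J_def by (rule hideal_image[OF \<rho> I])
  have hJ: "hemiring (restr F J)" by (rule hemiring_restr[OF F J])
  define N where "N = ker_class \<Sigma> (restr F J)"
  have N: "hideal N (restr F J)" unfolding N_def by (rule hideal_ker[OF hJ])
  note Np = hideal_props[OF hJ N]
  define D where "D = factor (restr F J) N"
  define \<sigma> where "\<sigma> = bourne_rep (restr F J) N"
  have D: "hemiring D" and \<sigma>: "\<sigma> \<in> hemiring_hom (restr F J) D" "\<sigma> ` J = carrier D"
    using factor_hemiring[OF hJ N] factor_carrier(1)[OF hJ N] by (auto simp: D_def \<sigma>_def)
  have ss: "semisimple \<C> D" unfolding D_def N_def by (rule semisimple_factor_ker[OF hJ])
  have \<sigma>N: "\<sigma> y = \<zero>\<^bsub>D\<^esub>" if "y \<in> N" for y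
    using that Np(1,3) bourne_zero_iff[OF hJ N, of y] unfolding \<sigma>_def D_def by blast
  define g where "g x = \<sigma> (\<rho> x)" for x
  define P where "P = {i \<in> I. g i = \<zero>\<^bsub>D\<^esub>}"
  note G\<rho> = hemiring_homD[OF hemiring_hom_restr[OF \<rho>(1) Ip(1), folded J_def]]
  note G\<sigma> = hemiring_homD[OF \<sigma>(1)]
  have ghom: "g \<in> hemiring_hom (restr R I) D"
    unfolding hemiring_hom_def
    using G\<rho> G\<sigma> by (auto simp: g_def)
  have gim: "g ` I = carrier D" using \<sigma>(2) by (simp add: g_def J_def image_image)
  have hI: "hemiring (restr R I)" by (rule hemiring_restr[OF R I])
  have P: "hideal P (restr R I)"
    using hideal_vimage[OF hI ghom hideal_zero[OF D]] by (simp add: P_def)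
  note Pp = hideal_props[OF hI P]
  have KP: "k \<in> P" if "k \<in> K" "k \<in> I" for k
    using \<rho>K[OF that(1)] that(2) G\<sigma>(2) by (simp add: P_def g_def)
  have lift: "(i \<otimes> j, i' \<otimes> j) \<in> bourne (restr R I) P \<and> (j \<otimes> i, j \<otimes> i') \<in> bourne (restr R I) P"
    if i: "i \<in> I" "i' \<in> I" "j \<in> I" and e: "g i = g i'" for i i' j
  proof -
    have "\<rho> i \<in> J" "\<rho> i' \<in> J" using i by (auto simp: J_def)
    then have "(\<rho> i, \<rho> i') \<in> bourne (restr F J) N"
      using e bourne_rep_eq_iff[OF hJ N, of "\<rho> i" "\<rho> i'"] by (simp add: g_def \<sigma>_def)
    then obtain y y' where y: "y \<in> N" "y' \<in> N" "\<rho> i \<oplus>\<^bsub>F\<^esub> y = \<rho> i' \<oplus>\<^bsub>F\<^esub> y'"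
      by (auto simp: bourne_def)
    have "y \<in> J" "y' \<in> J" using y Np(1) by auto
    then obtain x x' where x: "x \<in> I" "x' \<in> I" "y = \<rho> x" "y' = \<rho> x'" by (auto simp: J_def)
    have xP: "x \<in> P" "x' \<in> P" using x y \<sigma>N by (auto simp: P_def g_def)
    have c: "i \<in> carrier R" "i' \<in> carrier R" "j \<in> carrier R" "x \<in> carrier R" "x' \<in> carrier R"
      using i x Ip(1) by auto
    have "\<rho> (i \<oplus> x) = \<rho> (i' \<oplus> x')" using y(3) x c hemiring_homD(3)[OF \<rho>(1)] by simp
    then have "(i \<oplus> x, i' \<oplus> x') \<in> bourne R K"
      using bourne_rep_eq_iff[OF R K] c by (simp add: \<rho>_def)
    then obtain k k' where k: "k \<in> K" "k' \<in> K" "(i \<oplus> x) \<oplus> k = (i' \<oplus> x') \<oplus> k'"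
      by (auto simp: bourne_def)
    have kc: "k \<in> carrier R" "k' \<in> carrier R" using k Kp(1) by auto
    have k3: "i \<oplus> (x \<oplus> k) = i' \<oplus> (x' \<oplus> k')" using k(3) c kc by (simp add: a_assoc)
    have "j \<otimes> i \<oplus> (j \<otimes> x \<oplus> j \<otimes> k) = j \<otimes> (i \<oplus> (x \<oplus> k))"
      using c kc by (simp add: r_distr)
    also have "\<dots> = j \<otimes> i' \<oplus> (j \<otimes> x' \<oplus> j \<otimes> k')"
      unfolding k3 using c kc by (simp add: r_distr)
    finally have l: "j \<otimes> i \<oplus> (j \<otimes> x \<oplus> j \<otimes> k) = j \<otimes> i' \<oplus> (j \<otimes> x' \<oplus> j \<otimes> k')" .
    have "i \<otimes> j \<oplus> (x \<otimes> j \<oplus> k \<otimes> j) = (i \<oplus> (x \<oplus> k)) \<otimes> j"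
      using c kc by (simp add: l_distr)
    also have "\<dots> = i' \<otimes> j \<oplus> (x' \<otimes> j \<oplus> k' \<otimes> j)"
      unfolding k3 using c kc by (simp add: l_distr)
    finally have r: "i \<otimes> j \<oplus> (x \<otimes> j \<oplus> k \<otimes> j) = i' \<otimes> j \<oplus> (x' \<otimes> j \<oplus> k' \<otimes> j)" .
    have kP: "j \<otimes> k \<in> P" "j \<otimes> k' \<in> P" "k \<otimes> j \<in> P" "k' \<otimes> j \<in> P"
      by (rule KP[OF Kp(4)[OF k(1) c(3)] Ip(5)[OF i(3) kc(1)]],
        rule KP[OF Kp(4)[OF k(2) c(3)] Ip(5)[OF i(3) kc(2)]],
        rule KP[OF Kp(5)[OF k(1) c(3)] Ip(4)[OF i(3) kc(1)]],
        rule KP[OF Kp(5)[OF k(2) c(3)] Ip(4)[OF i(3) kc(2)]])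
    have xP': "j \<otimes> x \<in> P" "j \<otimes> x' \<in> P" "x \<otimes> j \<in> P" "x' \<otimes> j \<in> P"
      using Pp(4)[OF xP(1), of j] Pp(4)[OF xP(2), of j] Pp(5)[OF xP(1), of j] Pp(5)[OF xP(2), of j] i
      by simp_all
    have s: "j \<otimes> x \<oplus> j \<otimes> k \<in> P" "j \<otimes> x' \<oplus> j \<otimes> k' \<in> P" "x \<otimes> j \<oplus> k \<otimes> j \<in> P" "x' \<otimes> j \<oplus> k' \<otimes> j \<in> P"
      using Pp(3) kP xP' by simp_all
    have p: "i \<otimes> j \<in> I" "i' \<otimes> j \<in> I" "j \<otimes> i \<in> I" "j \<otimes> i' \<in> I"
      using Ip(4) i c by simp_all
    show ?thesis
    proof
      show "(i \<otimes> j, i' \<otimes> j) \<in> bourne (restr R I) P"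
        unfolding bourne_def using p(1,2) s(3,4) r by fastforce
      show "(j \<otimes> i, j \<otimes> i') \<in> bourne (restr R I) P"
        unfolding bourne_def using p(3,4) s(1,2) l by fastforce
    qed
  qed
  have D0: "carrier D = {\<zero>\<^bsub>D\<^esub>}"
    by (rule semisimple_image_trivial[OF C D ss ghom, of P]) (use gim lift in \<open>auto simp: P_def\<close>)
  have "y \<in> N" if y: "y \<in> J" for y
  proof -
    have "\<sigma> y = \<zero>\<^bsub>D\<^esub>" using D0 y \<sigma>(2) by blast
    then obtain z where "z \<in> N" "y \<oplus>\<^bsub>restr F J\<^esub> z \<in> N"
      using bourne_zero_iff[OF hJ N, of y] y by (auto simp: \<sigma>_def D_def)
    then show ?thesis using ker_subtractive[OF hJ, of y z] y by (simp add: N_def)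
  qed
  then have "ker_class \<Sigma> (restr F J) = carrier (restr F J)"
    using Np(1) by (auto simp: N_def)
  then have "restr F J \<in> \<C>" using rad_class_eq_ker[OF hJ] by simp
  moreover have "semisimple \<C> F" unfolding F_def K_def by (rule semisimple_factor_ker[OF R])
  ultimately have J0: "J = {\<zero>\<^bsub>F\<^esub>}" using J semisimple_iff[OF F] by blast
  have "i \<in> K" if i: "i \<in> I" for i
  proof -
    have ic: "i \<in> carrier R" using i Ip(1) by blast
    have "\<rho> i = \<zero>\<^bsub>F\<^esub>" using J0 i by (auto simp: J_def)
    then obtain k where "k \<in> K" "i \<oplus> k \<in> K"
      using bourne_zero_iff[OF R K ic] by (auto simp: \<rho>_def F_def)
    then show ?thesis using ker_subtractive[OF R ic] by (simp add: K_def)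
  qed
  then show ?thesis by (auto simp: K_def)
qed

lemma rad_ideal_subset_ker_restr:
  assumes R: "hemiring R" and W: "hideal W R" and I: "hideal I R" "restr R I \<in> \<C>" "I \<subseteq> W"
  shows "I \<subseteq> ker_class \<Sigma> (restr R W)"
proof -
  have "hideal I (restr R W)" by (rule hideal_restr[OF I(1,3) hideal_props(1)[OF R W]])
  from rad_ideal_subset_ker[OF hemiring_restr[OF R W] this] show ?thesis using I(2) by simp
qed

lemma rad_restr_if_ker:
  assumes R: "hemiring R" and W: "hideal W R" and k: "W \<subseteq> ker_class \<Sigma> (restr R W)"
  shows "restr R W \<in> \<C>"
proof -
  have "ker_class \<Sigma> (restr R W) \<subseteq> W" by (simp add: ker_class_def)
  then show ?thesis using rad_class_eq_ker[OF hemiring_restr[OF R W]] k by simp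
qed

text \<open>If an ideal \<open>L\<close> is a sum or a union of ideals in \<open>\<C>\<close>, each of these lies in \<open>ker(\<Sigma>\<^sub>L)\<close> by
  \<open>rad_ideal_subset_ker\<close>, so \<open>ker(\<Sigma>\<^sub>L) = L\<close>. For sums this shows that the union of all ideals in \<open>\<C>\<close>
  is an ideal; for that union it shows membership in \<open>\<C>\<close>.\<close>

lemma radical_ideal:
  fixes R :: "'u ring" (structure)
  assumes R: "hemiring R"
  shows "hideal (radical \<C> R) R" "restr R (radical \<C> R) \<in> \<C>"
proof -
  interpret hemiring R by fact
  let ?W = "radical \<C> R"
  have sum: "a \<oplus> b \<in> ?W"
    if I: "hideal I R" "restr R I \<in> \<C>" "a \<in> I" and J: "hideal J R" "restr R J \<in> \<C>" "b \<in> J" for I J a b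
  proof -
    note Ip = hideal_props[OF R I(1)] and Jp = hideal_props[OF R J(1)]
    have Ic: "x \<in> carrier R" if "x \<in> I" for x using that Ip(1) by blast
    have Jc: "x \<in> carrier R" if "x \<in> J" for x using that Jp(1) by blast
    define L where "L = {x \<oplus> y | x y. x \<in> I \<and> y \<in> J}"
    have LI: "x \<oplus> y \<in> L" if "x \<in> I" "y \<in> J" for x y using that by (auto simp: L_def)
    have L: "hideal L R"
      unfolding hideal_iff
    proof (intro conjI ballI)
      show "L \<subseteq> carrier R" using Ic Jc by (auto simp: L_def)
      show "\<zero> \<in> L" using LI[OF Ip(2) Jp(2)] by simp
      fix u assume "u \<in> L"
      then obtain x y where x: "x \<in> I" "y \<in> J" and u: "u = x \<oplus> y" by (auto simp: L_def)
      show "u \<oplus> v \<in> L" if vL: "v \<in> L" for v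
      proof -
        obtain x' y' where x': "x' \<in> I" "y' \<in> J" and v: "v = x' \<oplus> y'"
          using vL by (auto simp: L_def)
        have "u \<oplus> v = (x \<oplus> x') \<oplus> (y \<oplus> y')"
          unfolding u v using x x' Ic Jc by (simp add: a_ac)
        then show ?thesis using LI[OF Ip(3) Jp(3)] x x' by simp
      qed
      fix r assume r: "r \<in> carrier R"
      have "r \<otimes> u = r \<otimes> x \<oplus> r \<otimes> y" unfolding u using x r Ic Jc by (simp add: r_distr)
      then show "r \<otimes> u \<in> L" using LI[OF Ip(4) Jp(4)] x r by simp
      have "u \<otimes> r = x \<otimes> r \<oplus> y \<otimes> r" unfolding u using x r Ic Jc by (simp add: l_distr)
      then show "u \<otimes> r \<in> L" using LI[OF Ip(5) Jp(5)] x r by simp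
    qed
    let ?K = "ker_class \<Sigma> (restr R L)"
    have "x \<in> L" if "x \<in> I" for x using LI[OF that Jp(2)] Ic[OF that] by simp
    moreover have "y \<in> L" if "y \<in> J" for y using LI[OF Ip(2) that] Jc[OF that] by simp
    ultimately have IJ: "I \<subseteq> ?K" "J \<subseteq> ?K"
      using rad_ideal_subset_ker_restr[OF R L] I J by (meson subsetI)+
    have "x \<oplus> y \<in> ?K" if "x \<in> I" "y \<in> J" for x y
      using hideal_props(3)[OF hemiring_restr[OF R L] hideal_ker[OF hemiring_restr[OF R L]], of x y]
        that IJ by auto
    then have "L \<subseteq> ?K" by (auto simp: L_def)
    then have "restr R L \<in> \<C>" by (rule rad_restr_if_ker[OF R L])
    then show ?thesis using L LI[OF I(3) J(3)] unfolding radical_def by blast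
  qed
  show W: "hideal ?W R"
    unfolding hideal_iff
  proof (intro conjI ballI)
    show "?W \<subseteq> carrier R" by (auto simp: radical_def hideal_iff)
    show "\<zero> \<in> ?W" using hideal_zero[OF R] restr_zero_rad[OF R] unfolding radical_def by blast
    show "x \<oplus> y \<in> ?W" if "x \<in> ?W" "y \<in> ?W" for x y
      using that sum unfolding radical_def[of _ R] by blast
    show "r \<otimes> x \<in> ?W" "x \<otimes> r \<in> ?W" if xW: "x \<in> ?W" and r: "r \<in> carrier R" for x r
    proof -
      obtain I where I: "hideal I R" "restr R I \<in> \<C>" "x \<in> I"
        using xW unfolding radical_def by blast
      have "r \<otimes> x \<in> I" "x \<otimes> r \<in> I"
        using hideal_props(4,5)[OF R I(1) I(3) r] by blast+
      then show "r \<otimes> x \<in> ?W" "x \<otimes> r \<in> ?W" using I(1,2) unfolding radical_def by blast+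
    qed
  qed
  have "?W \<subseteq> ker_class \<Sigma> (restr R ?W)"
  proof
    fix x assume "x \<in> ?W"
    then obtain I where I: "hideal I R" "restr R I \<in> \<C>" "x \<in> I" by (auto simp: radical_def)
    then have "I \<subseteq> ?W" by (auto simp: radical_def)
    then show "x \<in> ker_class \<Sigma> (restr R ?W)"
      using rad_ideal_subset_ker_restr[OF R W I(1,2)] I(3) by blast
  qed
  then show "restr R ?W \<in> \<C>" by (rule rad_restr_if_ker[OF R W])
qed

text \<open>Closure of \<open>\<C>\<close> under extensions of \<open>W\<close> by \<open>J\<close>: a semimodule in \<open>\<Sigma>\<close> over the preimage \<open>B\<close> is
  annihilated by \<open>W\<close>, so by (SM2) it lives over \<open>B/W \<cong> J\<close>. For \<open>J = 0\<close> this puts the subtractive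
  closure of \<open>W\<close> in \<open>\<C>\<close>.\<close>

lemma rad_extension:
  assumes R: "hemiring R" and W: "hideal W R" "restr R W \<in> \<C>"
    and J: "hideal J (factor R W)" "restr (factor R W) J \<in> \<C>"
  defines "B \<equiv> {r \<in> carrier R. bourne_rep R W r \<in> J}"
  shows "hideal B R" "restr R B \<in> \<C>"
proof -
  let ?\<rho> = "bourne_rep R W" and ?F = "factor R W"
  note \<rho> = factor_hemiring(1)[OF R W(1)] and F = factor_hemiring(2)[OF R W(1)]
  show B: "hideal B R" unfolding B_def by (rule hideal_vimage[OF R \<rho> J(1)])
  have hB: "hemiring (restr R B)" by (rule hemiring_restr[OF R B])
  have hJ: "hemiring (restr ?F J)" by (rule hemiring_restr[OF F J(1)])
  note Wp = hideal_props[OF R W(1)]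
  have \<rho>W: "?\<rho> w = \<zero>\<^bsub>?F\<^esub>" if "w \<in> W" for w
    using that Wp bourne_zero_iff[OF R W(1), of w] by blast
  have WB: "W \<subseteq> B" using \<rho>W Wp(1) hideal_props(2)[OF F J(1)] by (auto simp: B_def)
  have Bc: "B \<subseteq> carrier R" by (auto simp: B_def)
  have "J \<subseteq> ?\<rho> ` carrier R"
    using hideal_props(1)[OF F J(1)] factor_carrier(1)[OF R W(1)] by simp
  then have im: "?\<rho> ` B = J" by (auto simp: B_def)
  have WiB: "hideal W (restr R B)" by (rule hideal_restr[OF W(1) WB Bc])
  have "?\<rho> \<in> hemiring_iso (factor (restr R B) W) (restr ?F J)"
  proof (rule factor_iso[OF hB hJ WiB])
    show "?\<rho> \<in> hemiring_hom (restr R B) (restr ?F J)"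
      using hemiring_hom_restr[OF \<rho> Bc] by (simp add: im)
    show "?\<rho> ` carrier (restr R B) = carrier (restr ?F J)" by (simp add: im)
    show "?\<rho> x = \<zero>\<^bsub>restr ?F J\<^esub>" if "x \<in> W" for x using \<rho>W[OF that] by simp
    show "(x, y) \<in> bourne (restr R B) W"
      if "x \<in> carrier (restr R B)" "y \<in> carrier (restr R B)" "?\<rho> x = ?\<rho> y" for x y
      using bourne_rep_eq_iff[OF R W(1), of x y] that Bc by (auto simp: bourne_def)
  qed
  then have "factor (restr R B) W \<in> \<C>"
    using rad_iso[OF J(2)] hemiring_iso_inv factor_hemiring(2)[OF hB WiB] by blast
  then have E: "\<Sigma> (factor (restr R B) W) = {}" by (simp add: rad_class_def)
  have "W \<subseteq> annihilator (restr R B) M" if "M \<in> \<Sigma> (restr R B)" for M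
    using rad_ideal_subset_ker_restr[OF R B W WB] that by (auto simp: ker_class_def)
  then have "\<Sigma> (restr R B) = {}" using SM2[OF hB WiB] E by blast
  then show "restr R B \<in> \<C>" using hB by (simp add: rad_class_def)
qed

text \<open>For \<open>ker(\<Sigma>\<^sub>R) \<subseteq> W\<close> the extension property is used twice: for arbitrary \<open>J\<close> to see that \<open>R/W\<close> is
  semisimple, and for \<open>J = 0\<close> to see that \<open>W\<close> is subtractive, so that elements which vanish in
  \<open>R/W\<close> lie in \<open>W\<close>.\<close>

theorem radical_eq_ker:
  assumes R: "hemiring R" shows "radical \<C> R = ker_class \<Sigma> R"
proof
  show "radical \<C> R \<subseteq> ker_class \<Sigma> R"
    using rad_ideal_subset_ker[OF R] unfolding radical_def by blast
  let ?W = "radical \<C> R"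
  let ?F = "factor R ?W"
  note W = radical_ideal[OF R]
  note F = factor_hemiring(2)[OF R W(1)]
  have ext: "{r \<in> carrier R. bourne_rep R ?W r \<in> J} \<subseteq> ?W"
    if "hideal J ?F" "restr ?F J \<in> \<C>" for J
    using rad_extension[OF R W that] unfolding radical_def[of _ R] by blast
  have "J = {\<zero>\<^bsub>?F\<^esub>}" if J: "hideal J ?F" "restr ?F J \<in> \<C>" for J
  proof -
    note Jp = hideal_props[OF F J(1)] and Wp = hideal_props[OF R W(1)]
    have "j = \<zero>\<^bsub>?F\<^esub>" if j: "j \<in> J" for j
    proof -
      obtain r where r: "r \<in> carrier R" "j = bourne_rep R ?W r"
        using j Jp(1) factor_carrier(1)[OF R W(1)] by blast
      then have "r \<in> ?W" using ext[OF J] j by blast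
      then show ?thesis using bourne_zero_iff[OF R W(1) r(1)] r(2) Wp(3) by blast
    qed
    then show ?thesis using Jp(2) by blast
  qed
  then have "semisimple \<C> ?F" using semisimple_iff[OF F] by blast
  then have k: "ker_class \<Sigma> ?F = {\<zero>\<^bsub>?F\<^esub>}" using semisimple_iff_ker[OF F] by simp
  show "ker_class \<Sigma> R \<subseteq> ?W"
  proof
    fix x assume x: "x \<in> ker_class \<Sigma> R"
    then have "x \<in> carrier R" by (simp add: ker_class_def)
    moreover have "bourne_rep R ?W x \<in> {\<zero>\<^bsub>?F\<^esub>}" using ker_rep[OF R W(1) x] k by simp
    ultimately show "x \<in> ?W" using ext[OF hideal_zero[OF F] restr_zero_rad[OF F]] by blast
  qed
qed

section \<open>Semisimple hemirings as subdirect products\<close>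

lemma factor_annihilator_faithful:
  assumes R: "hemiring R" and M: "M \<in> \<Sigma> R"
  shows "factor R (annihilator R M) \<in> faithful_class \<Sigma>"
proof -
  let ?A = "annihilator R M"
  have A: "hideal ?A R"
    by (rule left_semimodule.hideal_annihilator[OF semimodules[OF R M, THEN conjunct1]])
  note F = factor_hemiring(2)[OF R A] and c = factor_carrier[OF R A]
  have MF: "M \<in> \<Sigma> (factor R ?A)" by (rule SM2[OF R A M subset_refl])
  have "hideal (annihilator (factor R ?A) M) (factor R ?A)"
    by (rule left_semimodule.hideal_annihilator[OF semimodules[OF F MF, THEN conjunct1]])
  moreover have "s = \<zero>\<^bsub>factor R ?A\<^esub>" if s: "s \<in> annihilator (factor R ?A) M" for s
  proof -
    have sF: "s \<in> carrier (factor R ?A)" using s by (simp add: annihilator_def)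
    then have "s \<in> ?A" using s c(2) by (auto simp: annihilator_def)
    then show ?thesis
      using bourne_zero_iff[OF R A, of s] hideal_props[OF R A] c(4)[OF sF] by force
  qed
  ultimately have "annihilator (factor R ?A) M = {\<zero>\<^bsub>factor R ?A\<^esub>}" by (auto simp: hideal_iff)
  then show ?thesis using F MF by (auto simp: faithful_class_def)
qed

text \<open>The factors are indexed by the annihilators rather than by the semimodules, which makes the
  index type \<open>'u set\<close>. The kernel of \<open>R \<rightarrow> \<Prod> R/(0:M)\<close> is \<open>ker(\<Sigma>\<^sub>R)\<close>, by subtractivity of the
  annihilators.\<close>

lemma semisimple_imp_subdirect:
  fixes R :: "'u ring" (structure)
  assumes R: "hemiring R" and ss: "semisimple \<C> R"
  shows "semiiso_subdirect TYPE('u set) (faithful_class \<Sigma>) R"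
proof -
  interpret hemiring R by fact
  define A where "A = annihilator R ` \<Sigma> R"
  define f where "f r = (\<lambda>P\<in>A. bourne_rep R P r)" for r
  define S where "S = f ` carrier R"
  let ?DP = "direct_product A (factor R)"
  have Aid: "hideal P R" if "P \<in> A" for P
    using that left_semimodule.hideal_annihilator[OF semimodules[OF R, THEN conjunct1]]
    by (auto simp: A_def)
  have faith: "\<forall>P\<in>A. factor R P \<in> faithful_class \<Sigma>"
    using factor_annihilator_faithful[OF R] by (auto simp: A_def)
  note H = hemiring_homD[OF factor_hemiring(1)[OF R Aid]]
  have hom: "f \<in> hemiring_hom R ?DP"
    using H by (auto simp: hemiring_hom_def direct_product_def f_def fun_eq_iff restrict_def)
  note fh = hemiring_homD[OF hom]
  have sub: "subdirect_product A (factor R) S"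
    unfolding subdirect_product_def subhemiring_def
  proof (intro conjI ballI)
    show "submonoid S (add_monoid ?DP)"
      unfolding S_def submonoid_def
    proof (intro conjI allI impI)
      show "f ` carrier R \<subseteq> carrier (add_monoid ?DP)" using fh(1) by auto
      show "\<one>\<^bsub>add_monoid ?DP\<^esub> \<in> f ` carrier R" using fh(2) by force
      show "x \<otimes>\<^bsub>add_monoid ?DP\<^esub> y \<in> f ` carrier R" if "x \<in> f ` carrier R" "y \<in> f ` carrier R" for x y
        using that fh(3)[symmetric] by auto
    qed
    show "x \<otimes>\<^bsub>?DP\<^esub> y \<in> S" if "x \<in> S" "y \<in> S" for x y
      using that fh(4)[symmetric] m_closed by (auto simp: S_def)
    show "(\<lambda>x. x P) ` S = carrier (factor R P)" if "P \<in> A" for P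
      using that factor_carrier(1)[OF R Aid[OF that]] by (simp add: S_def f_def image_image)
  qed
  have ker: "r = \<zero>" if r: "r \<in> carrier R" "f r = \<zero>\<^bsub>?DP\<^esub>" for r
  proof -
    have "r \<in> annihilator R M" if M: "M \<in> \<Sigma> R" for M
    proof -
      have P: "annihilator R M \<in> A" using M by (simp add: A_def)
      have "bourne_rep R (annihilator R M) r = \<zero>\<^bsub>factor R (annihilator R M)\<^esub>"
        using fun_cong[OF r(2), of "annihilator R M"] P by (simp add: f_def direct_product_def)
      then obtain x where "x \<in> annihilator R M" "r \<oplus> x \<in> annihilator R M"
        using bourne_zero_iff[OF R Aid[OF P] r(1)] by blast
      then show ?thesis
        by (rule left_semimodule.annihilator_subtractive[OF semimodules[OF R M, THEN conjunct1] r(1)])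
    qed
    then have "r \<in> ker_class \<Sigma> R" using r(1) by (auto simp: ker_class_def)
    then show ?thesis using ss semisimple_iff_ker[OF R] by simp
  qed
  have "semiisomorphism R (restr ?DP S) f"
    unfolding semiisomorphism_def
  proof (intro conjI)
    show "f \<in> hemiring_hom R (restr ?DP S)"
      using hemiring_hom_restr[OF hom subset_refl] by (simp add: S_def)
    show "f ` carrier R = carrier (restr ?DP S)" by (simp add: S_def)
    show "{a \<in> carrier R. f a = \<zero>\<^bsub>restr ?DP S\<^esub>} = {\<zero>}" using ker fh(2) by auto
  qed
  then show ?thesis unfolding semiiso_subdirect_def using faith sub by blast
qed

lemma faithful_imp_semisimple:
  assumes "S \<in> faithful_class \<Sigma>" shows "semisimple \<C> S"
proof -
  have S: "hemiring S" using assms by (simp add: faithful_class_def)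
  have "ker_class \<Sigma> S \<subseteq> {\<zero>\<^bsub>S\<^esub>}" using assms by (auto simp: faithful_class_def ker_class_def)
  moreover have "\<zero>\<^bsub>S\<^esub> \<in> ker_class \<Sigma> S" using hideal_ker[OF S] by (simp add: hideal_iff)
  ultimately show ?thesis using semisimple_iff_ker[OF S] by blast
qed

text \<open>The image of an ideal under a coordinate projection is an ideal of that factor, but need
  not be a Bourne factor of the given ideal; this is where \<open>hom_closed\<close> enters.\<close>

lemma subdirect_imp_semisimple:
  assumes R: "hemiring R" and closed: "hom_closed \<C>"
    and sub: "semiiso_subdirect TYPE('i) (faithful_class \<Sigma>) R"
  shows "semisimple \<C> R"
  unfolding semisimple_iff[OF R]
proof (intro allI impI)
  fix I assume I: "hideal I R" "restr R I \<in> \<C>"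
  note Ip = hideal_props[OF R I(1)]
  obtain A :: "'i set" and \<R> S f where faith: "\<And>i. i \<in> A \<Longrightarrow> \<R> i \<in> faithful_class \<Sigma>"
    and S: "subdirect_product A \<R> S" and f: "semiisomorphism R (restr (direct_product A \<R>) S) f"
    using sub unfolding semiiso_subdirect_def by blast
  have fh: "f \<in> hemiring_hom R (restr (direct_product A \<R>) S)" and fS: "f ` carrier R = S"
    and fk: "\<And>a. a \<in> carrier R \<Longrightarrow> f a = \<zero>\<^bsub>direct_product A \<R>\<^esub> \<Longrightarrow> a = \<zero>\<^bsub>R\<^esub>"
    using f by (auto simp: semiisomorphism_def)
  note H = hemiring_homD[OF fh]
  have zero: "f x i = \<zero>\<^bsub>\<R> i\<^esub>" if i: "i \<in> A" and x: "x \<in> I" for i x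
  proof -
    let ?p = "\<lambda>r. f r i"
    have Ri: "hemiring (\<R> i)" using faith[OF i] by (simp add: faithful_class_def)
    have im: "?p ` carrier R = carrier (\<R> i)"
      using S i fS by (auto simp: subdirect_product_def image_image[symmetric])
    have p: "?p \<in> hemiring_hom R (\<R> i)"
      using H i im by (auto simp: hemiring_hom_def direct_product_def)
    have J: "hideal (?p ` I) (\<R> i)" by (rule hideal_image[OF p im I(1)])
    have "restr (\<R> i) (?p ` I) \<in> \<C>"
      using closed I(2) hemiring_restr[OF Ri J] hemiring_hom_restr[OF p Ip(1)]
      unfolding hom_closed_def by fastforce
    then have "?p ` I = {\<zero>\<^bsub>\<R> i\<^esub>}"
      using faithful_imp_semisimple[OF faith[OF i]] semisimple_iff[OF Ri] J by blast
    then show ?thesis using x by blast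
  qed
  have "x = \<zero>\<^bsub>R\<^esub>" if x: "x \<in> I" for x
  proof (rule fk)
    show xc: "x \<in> carrier R" using x Ip(1) by blast
    have "S \<subseteq> carrier (direct_product A \<R>)"
      using S by (auto simp: subdirect_product_def subhemiring_def submonoid_def)
    then have "f x \<in> (\<Pi>\<^sub>E i\<in>A. carrier (\<R> i))"
      using xc fS by (auto simp: direct_product_def)
    then have "f x = (\<lambda>i\<in>A. \<zero>\<^bsub>\<R> i\<^esub>)"
      using zero[OF _ x] by (intro ext) (auto simp: PiE_iff extensional_def)
    then show "f x = \<zero>\<^bsub>direct_product A \<R>\<^esub>" by (simp add: direct_product_def)
  qed
  then show "I = {\<zero>\<^bsub>R\<^esub>}" using Ip(2) by blast
qed

end

theorem theorem3p3:
  fixes \<Sigma> :: "('u, 'm) semimod_classes" and R :: "'u ring"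
  assumes universe: "infinite (UNIV :: 'u set)"
    and semimodules: "\<And>R M. hemiring R \<Longrightarrow> M \<in> \<Sigma> R \<Longrightarrow>
      left_semimodule R M \<and> smult_image R M \<noteq> {\<zero>\<^bsub>M\<^esub>}"
    and abstract: "iso_closed (rad_class \<Sigma>)"
    and SM1: "\<And>R I M. hemiring R \<Longrightarrow> hideal I R \<Longrightarrow> M \<in> \<Sigma> (factor R I) \<Longrightarrow>
      inflate R I M \<in> \<Sigma> R"
    and SM2: "\<And>R I M. hemiring R \<Longrightarrow> hideal I R \<Longrightarrow> M \<in> \<Sigma> R \<Longrightarrow> I \<subseteq> annihilator R M \<Longrightarrow>
      M \<in> \<Sigma> (factor R I)"
    and SM3: "\<And>R I. hemiring R \<Longrightarrow> ker_class \<Sigma> R = {\<zero>\<^bsub>R\<^esub>} \<Longrightarrow>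
      hideal I R \<Longrightarrow> I \<noteq> {\<zero>\<^bsub>R\<^esub>} \<Longrightarrow> \<Sigma> (restr R I) \<noteq> {}"
    and SM4: "\<And>R. hemiring R \<Longrightarrow>
      (\<And>I. hideal I R \<Longrightarrow> I \<noteq> {\<zero>\<^bsub>R\<^esub>} \<Longrightarrow> \<Sigma> (restr R I) \<noteq> {}) \<Longrightarrow> ker_class \<Sigma> R = {\<zero>\<^bsub>R\<^esub>}"
    and R: "hemiring R"
  shows
    "(semisimple (rad_class \<Sigma>) R \<longrightarrow>
        semiiso_subdirect TYPE('u set) (faithful_class \<Sigma>) R) \<and>
     (hom_closed (rad_class \<Sigma>) \<longrightarrow>
        (semisimple (rad_class \<Sigma>) R \<longleftrightarrow>
           semiiso_subdirect TYPE('u set) (faithful_class \<Sigma>) R) \<and>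
        (semiiso_subdirect TYPE('i) (faithful_class \<Sigma>) R \<longrightarrow> semisimple (rad_class \<Sigma>) R)) \<and>
     radical (rad_class \<Sigma>) R = ker_class \<Sigma> R"
proof -
  interpret radical_semimodules \<Sigma>
    by (rule radical_semimodules.intro[OF universe semimodules abstract SM1 SM2 SM3 SM4])
  have "semisimple (rad_class \<Sigma>) R" if "hom_closed (rad_class \<Sigma>)"
    "semiiso_subdirect TYPE('u set) (faithful_class \<Sigma>) R"
    using that by (rule subdirect_imp_semisimple[OF R])
  moreover have "semisimple (rad_class \<Sigma>) R" if "hom_closed (rad_class \<Sigma>)"
    "semiiso_subdirect TYPE('i) (faithful_class \<Sigma>) R"
    using that by (rule subdirect_imp_semisimple[OF R])
  ultimately show ?thesis
    using semisimple_imp_subdirect[OF R] radical_eq_ker[OF R] by blast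
qed

end
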